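(* There exists a non-coordinatizable, $4/5$-entire sectionally complemented modular lattice $L$ of cardinality $\aleph_1$, which is in addition isomorphic to an ideal in a complemented modular lattice $L'$ with a spanning $5$-frame (so $L'$ is coordinatizable).
   Context: Rings are associative but not necessarily unital. A ring $R$ is (von Neumann) regular if for every $x\in R$ there is $y\in R$ with $xyx=x$. For a regular ring $R$, $\mathbb{L}(R):=\{xR\mid x\in R\}$, ordered by inclusion; it is a sectionally complemented modular lattice. A lattice is coordinatizable if it is isomorphic to $\mathbb{L}(R)$ for some (not necessarily unital) regular ring $R$. Let $L$ be a modular lattice with zero. A finite sequence $(a_0,\dots,a_{n-1})$ in $L$ is independent if $a_k\wedge\bigvee_{i<k}a_i=0$ for each $k<n$; $a=\bigoplus_{i<n}a_i$ means that $(a_i)_{i<n}$ is independent and $a=\bigvee_{i<n}a_i$ (in particular $a\oplus b=c$ means $a\wedge b=0$ and $a\vee b=c$). $L$ is sectionally complemented if for all $a\le b$ in $L$ there is $x\in L$ with $b=a\oplus x$. $L$ is complemented if it has a unit $1$ and for every $a\in L$ there is $x\in L$ with $a\oplus x=1$. For $a,b,x\in L$, $a\sim_x b$ means $a\oplus x=b\oplus x$ (both sums being independent), and $a\lesssim_x b$ means that $a\wedge x=b\wedge x=0$ and $a\vee x\le b\vee x$. The elements $a$ and $b$ are perspective (resp. $a$ is subperspective to $b$) if $a\sim_x b$ (resp. $a\lesssim_x b$) for some $x\in L$. An independent finite sequence is homogeneous if its entries are pairwise perspective. An ideal of a lattice is a nonempty lower subset closed under finite joins. An $n$-frame is a family $((a_i)_{0\le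 i<n},(c_i)_{1\le i<n})$ with $(a_i)_{i<n}$ independent and $a_0\sim_{c_i}a_i$ for each $1\le i<n$; it is spanning if $L$ has a unit $1$ and $1=\bigoplus_{i<n}a_i$. For positive integers $m\ge n$, a modular lattice $L$ with zero is $n/m$-entire if $L$ has an ideal $I$ and a homogeneous sequence $(a_i)_{i<m}$ such that, setting $a:=\bigoplus_{i<n}a_i$: (1) each $x\in I$ is a join of $m-n$ elements subperspective to $a_0$, and moreover $x\wedge a=0$; (2) $\{a\vee x\mid x\in I\}$ is cofinal in $L$ (i.e. every element of $L$ lies below some $a\vee x$ with $x\in I$). *)

theory Defs
  imports "HOL-Algebra.Lattice" "HOL-Algebra.Ring" "HOL-Algebra.Coset"
begin

unbundle cardinal_syntax

section \<open>Modular lattices with zero\<close>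

locale modular_lattice_zero = lattice L + weak_partial_order_bottom L for L (structure) +
  assumes modular:
    "\<lbrakk>x \<in> carrier L; y \<in> carrier L; z \<in> carrier L; x \<sqsubseteq> z\<rbrakk>
      \<Longrightarrow> x \<squnion> (y \<sqinter> z) = (x \<squnion> y) \<sqinter> z"

text \<open>Finite sequences of length \<open>n\<close> are functions on \<open>nat\<close> restricted to \<open>{..<n}\<close>.
  The join of the empty set is the zero of the lattice.\<close>

definition independent :: "('a, 'm) gorder_scheme \<Rightarrow> nat \<Rightarrow> (nat \<Rightarrow> 'a) \<Rightarrow> bool" where
  "independent L n a \<longleftrightarrow>
     (\<forall>k<n. a k \<in> carrier L) \<and> (\<forall>k<n. a k \<sqinter>\<^bsub>L\<^esub> (\<Squnion>\<^bsub>L\<^esub> (a ` {..<k})) = \<bottom>\<^bsub>L\<^esub>)"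

definition is_direct_sum :: "('a, 'm) gorder_scheme \<Rightarrow> nat \<Rightarrow> (nat \<Rightarrow> 'a) \<Rightarrow> 'a \<Rightarrow> bool" where
  "is_direct_sum L n a s \<longleftrightarrow> independent L n a \<and> s = \<Squnion>\<^bsub>L\<^esub> (a ` {..<n})"

definition is_direct_sum2 :: "('a, 'm) gorder_scheme \<Rightarrow> 'a \<Rightarrow> 'a \<Rightarrow> 'a \<Rightarrow> bool" where
  "is_direct_sum2 L a b s \<longleftrightarrow> a \<sqinter>\<^bsub>L\<^esub> b = \<bottom>\<^bsub>L\<^esub> \<and> s = a \<squnion>\<^bsub>L\<^esub> b"

locale sectionally_complemented_modular_lattice = modular_lattice_zero L for L (structure) +
  assumes sectional_complement:
    "\<lbrakk>a \<in> carrier L; b \<in> carrier L; a \<sqsubseteq> b\<rbrakk> \<Longrightarrow> \<exists>x\<in>carrier L. is_direct_sum2 L a x b"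

locale complemented_modular_lattice =
  modular_lattice_zero L + weak_partial_order_top L for L (structure) +
  assumes complement: "a \<in> carrier L \<Longrightarrow> \<exists>x\<in>carrier L. is_direct_sum2 L a x \<top>"

definition perspective_by :: "('a, 'm) gorder_scheme \<Rightarrow> 'a \<Rightarrow> 'a \<Rightarrow> 'a \<Rightarrow> bool" where
  "perspective_by L x a b \<longleftrightarrow>
     a \<sqinter>\<^bsub>L\<^esub> x = \<bottom>\<^bsub>L\<^esub> \<and> b \<sqinter>\<^bsub>L\<^esub> x = \<bottom>\<^bsub>L\<^esub> \<and> a \<squnion>\<^bsub>L\<^esub> x = b \<squnion>\<^bsub>L\<^esub> x"

definition subperspective_by :: "('a, 'm) gorder_scheme \<Rightarrow> 'a \<Rightarrow> 'a \<Rightarrow> 'a \<Rightarrow> bool" where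
  "subperspective_by L x a b \<longleftrightarrow>
     a \<sqinter>\<^bsub>L\<^esub> x = \<bottom>\<^bsub>L\<^esub> \<and> b \<sqinter>\<^bsub>L\<^esub> x = \<bottom>\<^bsub>L\<^esub> \<and> a \<squnion>\<^bsub>L\<^esub> x \<sqsubseteq>\<^bsub>L\<^esub> b \<squnion>\<^bsub>L\<^esub> x"

definition perspective :: "('a, 'm) gorder_scheme \<Rightarrow> 'a \<Rightarrow> 'a \<Rightarrow> bool" where
  "perspective L a b \<longleftrightarrow> (\<exists>x\<in>carrier L. perspective_by L x a b)"

definition subperspective :: "('a, 'm) gorder_scheme \<Rightarrow> 'a \<Rightarrow> 'a \<Rightarrow> bool" where
  "subperspective L a b \<longleftrightarrow> (\<exists>x\<in>carrier L. subperspective_by L x a b)"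

definition homogeneous :: "('a, 'm) gorder_scheme \<Rightarrow> nat \<Rightarrow> (nat \<Rightarrow> 'a) \<Rightarrow> bool" where
  "homogeneous L n a \<longleftrightarrow>
     independent L n a \<and> (\<forall>i<n. \<forall>j<n. perspective L (a i) (a j))"

definition lattice_ideal :: "('a, 'm) gorder_scheme \<Rightarrow> 'a set \<Rightarrow> bool" where
  "lattice_ideal L I \<longleftrightarrow>
     I \<subseteq> carrier L \<and> I \<noteq> {} \<and>
     (\<forall>x\<in>I. \<forall>y\<in>carrier L. y \<sqsubseteq>\<^bsub>L\<^esub> x \<longrightarrow> y \<in> I) \<and>
     (\<forall>x\<in>I. \<forall>y\<in>I. x \<squnion>\<^bsub>L\<^esub> y \<in> I)"

definition frame ::
  "('a, 'm) gorder_scheme \<Rightarrow> nat \<Rightarrow> (nat \<Rightarrow> 'a) \<Rightarrow> (nat \<Rightarrow> 'a) \<Rightarrow> bool" where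
  "frame L n a c \<longleftrightarrow>
     independent L n a \<and>
     (\<forall>i\<in>{1..<n}. c i \<in> carrier L \<and> perspective_by L (c i) (a 0) (a i))"

text \<open>Only meaningful when \<open>L\<close> has a unit, since \<open>\<top>\<close> is unspecified otherwise.\<close>

definition spanning_frame ::
  "('a, 'm) gorder_scheme \<Rightarrow> nat \<Rightarrow> (nat \<Rightarrow> 'a) \<Rightarrow> (nat \<Rightarrow> 'a) \<Rightarrow> bool" where
  "spanning_frame L n a c \<longleftrightarrow> frame L n a c \<and> is_direct_sum L n a \<top>\<^bsub>L\<^esub>"

text \<open>\<open>entire n m L\<close> says that \<open>L\<close> is \<open>n/m\<close>-entire.\<close>

definition entire :: "nat \<Rightarrow> nat \<Rightarrow> ('a, 'm) gorder_scheme \<Rightarrow> bool" where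
  "entire n m L \<longleftrightarrow>
     0 < n \<and> n \<le> m \<and> modular_lattice_zero L \<and>
     (\<exists>I a s. lattice_ideal L I \<and> homogeneous L m a \<and> is_direct_sum L n a s \<and>
        (\<forall>x\<in>I.
           (\<exists>b. (\<forall>i<m - n. b i \<in> carrier L \<and> subperspective L (b i) (a 0)) \<and>
                x = \<Squnion>\<^bsub>L\<^esub> (b ` {..<m - n})) \<and>
           x \<sqinter>\<^bsub>L\<^esub> s = \<bottom>\<^bsub>L\<^esub>) \<and>
        (\<forall>y\<in>carrier L. \<exists>x\<in>I. y \<sqsubseteq>\<^bsub>L\<^esub> s \<squnion>\<^bsub>L\<^esub> x))"

definition lattice_isomorphic ::
  "('a, 'm) gorder_scheme \<Rightarrow> ('b, 'n) gorder_scheme \<Rightarrow> bool" where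
  "lattice_isomorphic L M \<longleftrightarrow>
     (\<exists>f. bij_betw f (carrier L) (carrier M) \<and> order_emb L M f)"


section \<open>Regular rings and coordinatizability\<close>

text \<open>Not necessarily unital rings on the record type of HOL-Algebra; the field \<open>one\<close> of the
  record is ignored.\<close>

locale nonunital_ring = abelian_group R for R (structure) +
  assumes m_closed: "\<lbrakk>x \<in> carrier R; y \<in> carrier R\<rbrakk> \<Longrightarrow> x \<otimes> y \<in> carrier R"
    and m_assoc: "\<lbrakk>x \<in> carrier R; y \<in> carrier R; z \<in> carrier R\<rbrakk>
      \<Longrightarrow> (x \<otimes> y) \<otimes> z = x \<otimes> (y \<otimes> z)"
    and l_distr: "\<lbrakk>x \<in> carrier R; y \<in> carrier R; z \<in> carrier R\<rbrakk>
      \<Longrightarrow> (x \<oplus> y) \<otimes> z = x \<otimes> z \<oplus> y \<otimes> z"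
    and r_distr: "\<lbrakk>x \<in> carrier R; y \<in> carrier R; z \<in> carrier R\<rbrakk>
      \<Longrightarrow> z \<otimes> (x \<oplus> y) = z \<otimes> x \<oplus> z \<otimes> y"

locale regular_ring = nonunital_ring R for R (structure) +
  assumes regular: "x \<in> carrier R \<Longrightarrow> \<exists>y\<in>carrier R. x \<otimes> y \<otimes> x = x"

text \<open>The set \<open>x <# carrier R\<close> is \<open>xR\<close>.\<close>

definition right_ideal_lattice :: "('r, 'm) ring_scheme \<Rightarrow> 'r set gorder" where
  "right_ideal_lattice R =
     \<lparr>carrier = {x <#\<^bsub>R\<^esub> carrier R | x. x \<in> carrier R}, eq = (=), le = (\<subseteq>)\<rparr>"

lemma weak_partial_order_right_ideal_lattice: "weak_partial_order (right_ideal_lattice R)"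
  by unfold_locales (auto simp: right_ideal_lattice_def)

text \<open>A formula cannot quantify over all types, so the ring ranges over rings whose elements lie
  in the type \<open>'a + nat\<close>. This is no restriction: by the Loewenheim-Skolem type theorem
  \<open>coordinatizableI\<close> below, an isomorphism with the lattice of a regular ring on any type
  whatsoever makes a lattice coordinatizable in the present sense.\<close>

definition coordinatizable :: "('a, 'm) gorder_scheme \<Rightarrow> bool" where
  "coordinatizable L \<longleftrightarrow>
     (\<exists>R :: ('a + nat) ring. regular_ring R \<and> lattice_isomorphic L (right_ideal_lattice R))"

context regular_ring
begin

definition qinv :: "'a \<Rightarrow> 'a" where
  "qinv x = (SOME y. y \<in> carrier R \<and> x \<otimes> y \<otimes> x = x)"

lemma qinv: assumes "x \<in> carrier R"
  shows "qinv x \<in> carrier R" "x \<otimes> qinv x \<otimes> x = x"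
proof -
  have "\<exists>y. y \<in> carrier R \<and> x \<otimes> y \<otimes> x = x" using regular[OF assms] by blast
  from someI_ex[OF this] show "qinv x \<in> carrier R" "x \<otimes> qinv x \<otimes> x = x"
    unfolding qinv_def by blast+
qed

inductive_set gen :: "'a set \<Rightarrow> 'a set" for X where
  base: "x \<in> X \<Longrightarrow> x \<in> gen X"
| zero: "\<zero> \<in> gen X"
| add: "\<lbrakk>x \<in> gen X; y \<in> gen X\<rbrakk> \<Longrightarrow> x \<oplus> y \<in> gen X"
| mult: "\<lbrakk>x \<in> gen X; y \<in> gen X\<rbrakk> \<Longrightarrow> x \<otimes> y \<in> gen X"
| neg: "x \<in> gen X \<Longrightarrow> \<ominus> x \<in> gen X"
| qi: "x \<in> gen X \<Longrightarrow> qinv x \<in> gen X"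

lemma gen_carrier: "X \<subseteq> carrier R \<Longrightarrow> gen X \<subseteq> carrier R"
proof
  fix x assume X: "X \<subseteq> carrier R" and "x \<in> gen X"
  from this(2) show "x \<in> carrier R"
    by induction (use X in \<open>auto intro: m_closed qinv\<close>)
qed

definition gen_step :: "'a set \<Rightarrow> 'a set" where
  "gen_step Y = Y \<union> (\<lambda>(x, y). x \<oplus> y) ` (Y \<times> Y) \<union> (\<lambda>(x, y). x \<otimes> y) ` (Y \<times> Y)
     \<union> (\<lambda>x. \<ominus> x) ` Y \<union> qinv ` Y"

lemma gen_card:
  fixes U :: "'u set"
  assumes U: "\<not> finite U" and X: "|X| \<le>o |U|"
  shows "|gen X| \<le>o |U|"
proof -
  define Y where "Y n = (gen_step ^^ n) (insert \<zero> X)" for n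
  have YS: "Y (Suc n) = gen_step (Y n)" for n by (simp add: Y_def)
  have un: "|A \<union> B| \<le>o |U|" if "|A| \<le>o |U|" "|B| \<le>o |U|" for A B :: "'a set"
    by (rule card_of_Un_ordLeq_infinite_Field) (use that U in \<open>simp_all add: Field_card_of card_of_card_order_on\<close>)
  have im: "|p ` A| \<le>o |U|" if "|A| \<le>o |U|" for p :: "'a \<Rightarrow> 'a" and A
    using card_of_image that ordLeq_transitive by blast
  have im2: "|p ` A| \<le>o |U|" if "|A| \<le>o |U|" for p :: "'a \<times> 'a \<Rightarrow> 'a" and A
    using card_of_image that ordLeq_transitive by blast
  have tm: "|A \<times> A| \<le>o |U|" if "|A| \<le>o |U|" for A :: "'a set"
    by (rule card_of_Times_ordLeq_infinite_Field) (use that U in \<open>simp_all add: Field_card_of card_of_card_order_on\<close>)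
  have Yc: "|Y n| \<le>o |U|" for n
  proof (induction n)
    case 0
    have "|{\<zero>}| \<le>o |U|" using U by (intro card_of_singl_ordLeq) auto
    from un[OF this X] show ?case by (simp add: Y_def)
  next
    case (Suc n)
    then show ?case unfolding YS gen_step_def by (intro un im im2 tm)
  qed
  have mono: "Y m \<subseteq> Y n" if "m \<le> n" for m n
    using that by (rule lift_Suc_mono_le[rotated]) (auto simp: YS gen_step_def)
  have two: "\<exists>n. x \<in> Y n \<and> y \<in> Y n" if "x \<in> Y m" "y \<in> Y k" for x y m k
    using mono[of m "max m k"] mono[of k "max m k"] that by auto
  have "gen X \<subseteq> (\<Union>n. Y n)"
  proof
    fix x assume "x \<in> gen X"
    then show "x \<in> (\<Union>n. Y n)"
    proof induction
      case (base x)
      then have "x \<in> Y 0" by (simp add: Y_def)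
      then show ?case by blast
    next
      case zero
      have "\<zero> \<in> Y 0" by (simp add: Y_def)
      then show ?case by blast
    next
      case (add x y)
      then obtain n where "x \<in> Y n" "y \<in> Y n" using two by blast
      then have "x \<oplus> y \<in> Y (Suc n)" unfolding YS gen_step_def by force
      then show ?case by blast
    next
      case (mult x y)
      then obtain n where "x \<in> Y n" "y \<in> Y n" using two by blast
      then have "x \<otimes> y \<in> Y (Suc n)" unfolding YS gen_step_def by force
      then show ?case by blast
    next
      case (neg x)
      then obtain n where "x \<in> Y n" by blast
      then have "\<ominus> x \<in> Y (Suc n)" unfolding YS gen_step_def by blast
      then show ?case by blast
    next
      case (qi x)
      then obtain n where "x \<in> Y n" by blast
      then have "qinv x \<in> Y (Suc n)" unfolding YS gen_step_def by blast
      then show ?case by blast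
    qed
  qed
  moreover have "|\<Union>n. Y n| \<le>o |U|"
    by (rule card_of_UNION_ordLeq_infinite) (use U Yc infinite_iff_card_of_nat in auto)
  ultimately show ?thesis using card_of_mono1 ordLeq_transitive by blast
qed

lemma mem_rideal_iff:
  assumes "x \<in> S" "y \<in> S" "S \<subseteq> carrier R" "\<And>u v. u \<in> S \<Longrightarrow> v \<in> S \<Longrightarrow> u \<otimes> v \<in> S"
    "\<And>u. u \<in> S \<Longrightarrow> qinv u \<in> S"
  shows "x <# S \<subseteq> y <# S \<longleftrightarrow> y \<otimes> (qinv y \<otimes> x) = x"
proof
  assume "x <# S \<subseteq> y <# S"
  moreover have "x \<in> x <# S"
    using assms qinv[of x] m_assoc[of x "qinv x" x] unfolding l_coset_def
    by (auto intro!: bexI[of _ "qinv x \<otimes> x"])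
  ultimately obtain z where z: "z \<in> S" "x = y \<otimes> z" unfolding l_coset_def by auto
  have c: "x \<in> carrier R" "y \<in> carrier R" "z \<in> carrier R" "qinv y \<in> carrier R"
    using assms z qinv by auto
  have "y \<otimes> (qinv y \<otimes> x) = (y \<otimes> qinv y \<otimes> y) \<otimes> z"
    using z(2) c by (simp add: m_assoc m_closed)
  then show "y \<otimes> (qinv y \<otimes> x) = x" using qinv c z by simp
next
  assume e: "y \<otimes> (qinv y \<otimes> x) = x"
  show "x <# S \<subseteq> y <# S"
  proof
    fix w assume "w \<in> x <# S"
    then obtain z where z: "z \<in> S" "w = x \<otimes> z" unfolding l_coset_def by auto
    have c: "x \<in> carrier R" "y \<in> carrier R" "z \<in> carrier R" "qinv y \<in> carrier R"
      using assms z qinv by auto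
    have "w = y \<otimes> (qinv y \<otimes> x \<otimes> z)"
      using e z c m_assoc[of y "qinv y \<otimes> x" z] by (simp add: m_closed)
    then show "w \<in> y <# S" unfolding l_coset_def using assms z by auto
  qed
qed

end

theorem coordinatizableI:
  fixes L :: "('a, 'm) gorder_scheme" and R :: "('r, 'n) ring_scheme"
  assumes R: "regular_ring R" and iso: "lattice_isomorphic L (right_ideal_lattice R)"
  shows "coordinatizable L"
proof -
  interpret regular_ring R by (rule R)
  obtain f where f: "bij_betw f (carrier L) (carrier (right_ideal_lattice R))"
    and emb: "order_emb L (right_ideal_lattice R) f"
    using iso unfolding lattice_isomorphic_def by blast
  have fim: "f ` carrier L = {x <#\<^bsub>R\<^esub> carrier R | x. x \<in> carrier R}"
    using f unfolding bij_betw_def right_ideal_lattice_def by simp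
  have "\<exists>x. x \<in> carrier R \<and> f l = x <#\<^bsub>R\<^esub> carrier R" if "l \<in> carrier L" for l
  proof -
    have "f l \<in> {x <#\<^bsub>R\<^esub> carrier R | x. x \<in> carrier R}"
      unfolding fim[symmetric] using that by (rule imageI)
    then show ?thesis by blast
  qed
  then obtain g where g: "\<And>l. l \<in> carrier L \<Longrightarrow> g l \<in> carrier R"
    "\<And>l. l \<in> carrier L \<Longrightarrow> f l = g l <#\<^bsub>R\<^esub> carrier R" by metis
  define S where "S = gen (g ` carrier L)"
  have SR: "S \<subseteq> carrier R" unfolding S_def using g by (intro gen_carrier) auto
  have gS: "g l \<in> S" if "l \<in> carrier L" for l using that unfolding S_def by (auto intro: gen.base)
  have cl: "\<zero>\<^bsub>R\<^esub> \<in> S" "\<And>x y. x \<in> S \<Longrightarrow> y \<in> S \<Longrightarrow> x \<oplus>\<^bsub>R\<^esub> y \<in> S"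
    "\<And>x y. x \<in> S \<Longrightarrow> y \<in> S \<Longrightarrow> x \<otimes>\<^bsub>R\<^esub> y \<in> S" "\<And>x. x \<in> S \<Longrightarrow> \<ominus>\<^bsub>R\<^esub> x \<in> S"
    "\<And>x. x \<in> S \<Longrightarrow> qinv x \<in> S"
    unfolding S_def by (auto intro: gen.intros)
  have inf: "infinite (UNIV :: ('a + nat) set)" by simp
  have "|g ` carrier L| \<le>o |UNIV :: ('a + nat) set|"
  proof -
    have "|carrier L| \<le>o |UNIV :: ('a + nat) set|"
      using card_of_ordLeqI[of Inl "carrier L" UNIV] by simp
    then show ?thesis using card_of_image ordLeq_transitive by blast
  qed
  then have "|S| \<le>o |UNIV :: ('a + nat) set|" unfolding S_def by (rule gen_card[OF inf])
  then obtain h :: "'r \<Rightarrow> 'a + nat" where h: "inj_on h S"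
    unfolding card_of_ordLeq[symmetric] by blast
  define k where "k = inv_into S h"
  have kh[simp]: "k (h x) = x" if "x \<in> S" for x using h that by (simp add: k_def)
  define T :: "('a + nat) ring" where
    "T = \<lparr>carrier = h ` S, mult = (\<lambda>x y. h (k x \<otimes>\<^bsub>R\<^esub> k y)), one = undefined,
          zero = h \<zero>\<^bsub>R\<^esub>, add = (\<lambda>x y. h (k x \<oplus>\<^bsub>R\<^esub> k y))\<rparr>"
  have Ts[simp]: "carrier T = h ` S" "\<zero>\<^bsub>T\<^esub> = h \<zero>\<^bsub>R\<^esub>"
    "x \<otimes>\<^bsub>T\<^esub> y = h (k x \<otimes>\<^bsub>R\<^esub> k y)" "x \<oplus>\<^bsub>T\<^esub> y = h (k x \<oplus>\<^bsub>R\<^esub> k y)" for x y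
    by (simp_all add: T_def)
  note [simp] = cl
  have SRm[simp]: "x \<in> carrier R" if "x \<in> S" for x using SR that by blast
  have "abelian_group T"
  proof (rule abelian_groupI)
    fix x assume "x \<in> carrier T"
    then obtain s where s: "s \<in> S" "x = h s" by auto
    show "\<exists>y\<in>carrier T. y \<oplus>\<^bsub>T\<^esub> x = \<zero>\<^bsub>T\<^esub>"
      using s by (auto intro!: bexI[of _ "\<ominus>\<^bsub>R\<^esub> s"] simp: l_neg)
  qed (auto simp: a_ac intro!: arg_cong[of _ _ h])
  then interpret T: abelian_group T .
  have "regular_ring T"
  proof unfold_locales
    fix x assume "x \<in> carrier T"
    then obtain s where s: "s \<in> S" "x = h s" by auto
    then show "\<exists>y\<in>carrier T. x \<otimes>\<^bsub>T\<^esub> y \<otimes>\<^bsub>T\<^esub> x = x"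
      using qinv[of s] by (auto intro!: bexI[of _ "qinv s"])
  qed (auto simp: m_assoc l_distr r_distr intro!: arg_cong[of _ _ h])
  moreover have "lattice_isomorphic L (right_ideal_lattice T)"
  proof -
    define F where "F l = h (g l) <#\<^bsub>T\<^esub> carrier T" for l
    have F: "F l = h ` (g l <#\<^bsub>R\<^esub> S)" if "l \<in> carrier L" for l
      using gS[OF that] by (auto simp: F_def l_coset_def)
    have sub: "x <#\<^bsub>R\<^esub> S \<subseteq> S" if "x \<in> S" for x using that by (auto simp: l_coset_def)
    have dn: "x <#\<^bsub>R\<^esub> S \<subseteq> y <#\<^bsub>R\<^esub> S \<longleftrightarrow> x <#\<^bsub>R\<^esub> carrier R \<subseteq> y <#\<^bsub>R\<^esub> carrier R"
      if "x \<in> S" "y \<in> S" for x y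
      using mem_rideal_iff[of x S y] mem_rideal_iff[of x "carrier R" y] that SR
      by (simp add: m_closed qinv)
    have ord: "F l \<subseteq> F l' \<longleftrightarrow> f l \<subseteq> f l'" if "l \<in> carrier L" "l' \<in> carrier L" for l l'
    proof -
      have "h ` A \<subseteq> h ` B \<longleftrightarrow> A \<subseteq> B" if "A \<subseteq> S" "B \<subseteq> S" for A B
        using h that unfolding inj_on_def by blast
      from this[OF sub sub, OF gS gS, OF that] show ?thesis
        using that dn[of "g l" "g l'"] gS by (simp add: F g)
    qed
    have "inj_on F (carrier L)"
    proof (rule inj_onI)
      fix l l' assume l: "l \<in> carrier L" "l' \<in> carrier L" "F l = F l'"
      then have "f l = f l'" using ord[of l l'] ord[of l' l] by auto
      then show "l = l'" using l f by (auto simp: bij_betw_def inj_on_def)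
    qed
    moreover have "F ` carrier L = carrier (right_ideal_lattice T)"
    proof (rule antisym)
      show "F ` carrier L \<subseteq> carrier (right_ideal_lattice T)"
        using gS by (auto simp: F_def right_ideal_lattice_def)
      show "carrier (right_ideal_lattice T) \<subseteq> F ` carrier L"
      proof
        fix A assume "A \<in> carrier (right_ideal_lattice T)"
        then obtain s where s: "s \<in> S" "A = h s <#\<^bsub>T\<^esub> carrier T"
          by (auto simp: right_ideal_lattice_def)
        have A: "A = h ` (s <#\<^bsub>R\<^esub> S)" using s by (auto simp: l_coset_def)
        have "s <#\<^bsub>R\<^esub> carrier R \<in> f ` carrier L"
          unfolding fim using SRm[OF s(1)] by blast
        then obtain l where l: "l \<in> carrier L" "g l <#\<^bsub>R\<^esub> carrier R = s <#\<^bsub>R\<^esub> carrier R"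
          using g by auto
        then have "g l <#\<^bsub>R\<^esub> S = s <#\<^bsub>R\<^esub> S"
          using dn[of "g l" s] dn[of s "g l"] s gS by auto
        then show "A \<in> F ` carrier L" using A F l by auto
      qed
    qed
    moreover have "order_emb L (right_ideal_lattice T) F"
      using emb ord weak_partial_order_right_ideal_lattice[of T]
      by (simp add: order_emb_def right_ideal_lattice_def)
    ultimately show ?thesis unfolding lattice_isomorphic_def bij_betw_def by blast
  qed
  ultimately show ?thesis unfolding coordinatizable_def by blast
qed

end

(*
The ring S consists of families s(i, j, x), for i a natural number and j, x < omega_1, of
endomorphisms of V = X + Y, where X and Y are copies of one infinite dimensional space. Two
projections of V onto X are fixed: xpart with kernel Y and xskew with kernel the diagonal. In
every row i the values s(i, j, -) commute with xpart for all but finitely many j, and in every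
column j the values s(i, j, -) commute with xskew for all but finitely many i. All these families
form a regular ring, since quasi-inverses can be chosen to commute with whatever projection the
element commutes with, and S is a regular subring of cardinality aleph_1. Fix a coordinate
hyperplane W of V that contains X. L' consists of all principal right ideals of S, and L of
those whose values have range in W for all large x.

Suppose that L is isomorphic to the lattice of a regular ring R. Choose idempotents of R for the
right ideals generated by xpart on row i and by xskew on column j. On everything supported at
x < b, the lattice forces their kernels to be those of xpart and xskew outside a finite set of
points (i, j). These finite sets increase with b < omega_1, so finitely many exceptions suffice for
all b at once. With countably many rows and uncountably many columns, some point (i, j) is
exceptional neither for its row nor for its column. Some idempotent e of R has a right
annihilator contained in those of both idempotents, so at (i, j) its kernel lies in Y and in
the diagonal, hence is zero, and its range is all of V for every x. But its right ideal belongs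
to L, so that this range lies in W for large x.

Splitting the coordinates of V into five infinite blocks gives the frame of L'. Deleting from one
block the coordinate that cuts out W leaves a space isomorphic to the block, which makes L
4/5-entire.
*)

theory Submission
  imports Defs Complex_Main "HOL-Library.Function_Algebras" "HOL-Library.Countable_Set_Type"
begin

section \<open>Principal right ideals of a regular ring with unit\<close>

lemma sup_eqI:
  assumes "partial_order L" "least L l (Upper L T)"
  shows "\<Squnion>\<^bsub>L\<^esub> T = l"
proof -
  interpret partial_order L by fact
  have "least L (\<Squnion>\<^bsub>L\<^esub> T) (Upper L T)"
    unfolding sup_def by (rule someI[of _ l]) fact
  then show ?thesis using assms(2) least_unique by blast
qed

lemma inf_eqI:
  assumes "partial_order L" "greatest L l (Lower L T)"
  shows "\<Sqinter>\<^bsub>L\<^esub> T = l"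
proof -
  interpret partial_order L by fact
  have "greatest L (\<Sqinter>\<^bsub>L\<^esub> T) (Lower L T)"
    unfolding inf_def by (rule someI[of _ l]) fact
  then show ?thesis using assms(2) greatest_unique by blast
qed

text \<open>A set inside a type of class \<open>ring_1\<close>: the ring laws come from the class
  and only closure remains to be shown. The ring of the theorem is such a subset of a function
  type.\<close>

locale regular_subring =
  fixes S :: "'a::ring_1 set"
  assumes one_mem: "1 \<in> S"
    and diff_mem: "\<lbrakk>x \<in> S; y \<in> S\<rbrakk> \<Longrightarrow> x - y \<in> S"
    and mult_mem: "\<lbrakk>x \<in> S; y \<in> S\<rbrakk> \<Longrightarrow> x * y \<in> S"
    and ex_quasi_inverse: "x \<in> S \<Longrightarrow> \<exists>y\<in>S. x * y * x = x"
begin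

lemma zero_mem: "0 \<in> S"
  using diff_mem[OF one_mem one_mem] by simp

lemma uminus_mem: "x \<in> S \<Longrightarrow> - x \<in> S"
  using diff_mem[OF zero_mem] by fastforce

lemma add_mem: "\<lbrakk>x \<in> S; y \<in> S\<rbrakk> \<Longrightarrow> x + y \<in> S"
  using diff_mem[of x "- y"] uminus_mem by simp

lemmas mems = one_mem zero_mem diff_mem uminus_mem add_mem mult_mem

lemma sum_mem: "(\<And>i. i \<in> T \<Longrightarrow> f i \<in> S) \<Longrightarrow> sum f T \<in> S"
  by (induction T rule: infinite_finite_induct) (auto intro: mems)

definition rid :: "'a \<Rightarrow> 'a set" where
  "rid x = (*) x ` S"

definition rideals :: "'a set set" where
  "rideals = rid ` S"

definition psum :: "'a set \<Rightarrow> 'a set \<Rightarrow> 'a set" where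
  "psum A B = {a + b | a b. a \<in> A \<and> b \<in> B}"

lemma psumI: "\<lbrakk>a \<in> A; b \<in> B\<rbrakk> \<Longrightarrow> a + b \<in> psum A B"
  by (auto simp: psum_def)

lemma rid_rideals: "x \<in> S \<Longrightarrow> rid x \<in> rideals"
  by (simp add: rideals_def)

lemma rideal_subset: "A \<in> rideals \<Longrightarrow> A \<subseteq> S"
  by (auto simp: rideals_def rid_def intro: mems)

lemma rideal_mult: "\<lbrakk>A \<in> rideals; x \<in> A; r \<in> S\<rbrakk> \<Longrightarrow> x * r \<in> A"
  by (auto simp: rideals_def rid_def mult.assoc intro: mems)

lemma rideal_add: "\<lbrakk>A \<in> rideals; x \<in> A; y \<in> A\<rbrakk> \<Longrightarrow> x + y \<in> A"
  by (auto simp: rideals_def rid_def distrib_left[symmetric] intro: mems)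

lemma rideal_zero: "A \<in> rideals \<Longrightarrow> 0 \<in> A"
  by (auto simp: rideals_def rid_def image_iff intro!: bexI[of _ 0] mems)

lemma rideal_uminus: "\<lbrakk>A \<in> rideals; x \<in> A\<rbrakk> \<Longrightarrow> - x \<in> A"
  using rideal_mult[of A x "-1"] by (simp add: mems)

lemma rideal_diff: "\<lbrakk>A \<in> rideals; x \<in> A; y \<in> A\<rbrakk> \<Longrightarrow> x - y \<in> A"
  using rideal_add[of A x "-y"] rideal_uminus by simp

lemma rideal_sum: "\<lbrakk>A \<in> rideals; \<And>i. i \<in> T \<Longrightarrow> f i \<in> A\<rbrakk> \<Longrightarrow> sum f T \<in> A"
  by (induction T rule: infinite_finite_induct) (auto intro: rideal_zero rideal_add)

lemma rid_self: "x \<in> rid x"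
  by (auto simp: rid_def image_iff intro!: bexI[of _ 1] mems)

lemma rid_subset_iff: "A \<in> rideals \<Longrightarrow> rid x \<subseteq> A \<longleftrightarrow> x \<in> A"
  using rid_self rideal_mult by (fastforce simp: rid_def)

lemma rid_mult_subset: "\<lbrakk>x \<in> S; y \<in> S\<rbrakk> \<Longrightarrow> rid (x * y) \<subseteq> rid x"
  by (auto simp: rid_def mult.assoc intro: mems)

lemma mem_rid_idem: "\<lbrakk>e \<in> S; e * e = e\<rbrakk> \<Longrightarrow> x \<in> rid e \<longleftrightarrow> x \<in> S \<and> e * x = x"
  by (auto simp: rid_def mult.assoc[symmetric] intro: mems) (metis imageI)

lemma rid_zero: "rid 0 = {0}"
  using one_mem by (auto simp: rid_def)

lemma zero_rideals: "{0} \<in> rideals"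
  using rid_rideals[OF zero_mem] by (simp add: rid_zero)

lemma S_rideals: "S \<in> rideals"
proof -
  have "rid 1 = S" by (simp add: rid_def)
  then show ?thesis using rid_rideals[OF one_mem] by simp
qed

text \<open>If \<open>y\<close> is a quasi-inverse of \<open>x\<close>, then \<open>x * y\<close> is
  idempotent and fixes \<open>x\<close> from the left, so both generate the same right
  ideal.\<close>

lemma rideal_idem:
  assumes "A \<in> rideals"
  obtains e where "e \<in> S" "e * e = e" "A = rid e"
proof -
  obtain x where x: "x \<in> S" "A = rid x" using assms by (auto simp: rideals_def)
  obtain y where y: "y \<in> S" "x * y * x = x" using ex_quasi_inverse x(1) by blast
  have e: "x * y \<in> S" "(x * y) * (x * y) = x * y"
    using x y by (auto simp: mult.assoc[symmetric] intro: mems)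
  have "A = rid (x * y)"
  proof
    show "A \<subseteq> rid (x * y)"
      using x y e rid_subset_iff[OF rid_rideals[OF e(1)]] mem_rid_idem[OF e] by simp
    show "rid (x * y) \<subseteq> A" using x y rid_mult_subset by simp
  qed
  then show ?thesis using that e by blast
qed

text \<open>Modulo \<open>A = rid e\<close> the generator \<open>y\<close> of \<open>B\<close> may
  be replaced by \<open>(1 - e) * y\<close>. An idempotent \<open>f\<close> for the latter satisfies
  \<open>e * f = 0\<close>; correcting it to \<open>f * (1 - e)\<close> makes it orthogonal to
  \<open>e\<close> on both sides, and the sum of two orthogonal idempotents generates the sum of
  their ideals.\<close>

lemma psum_rideals:
  assumes "A \<in> rideals" "B \<in> rideals"
  shows "psum A B \<in> rideals"
proof -
  obtain e where e: "e \<in> S" "e * e = e" "A = rid e" using assms(1) by (rule rideal_idem)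
  obtain y where y: "y \<in> S" "B = rid y" using assms(2) by (auto simp: rideals_def)
  have b: "(1 - e) * y \<in> S" using e y by (auto intro: mems)
  obtain f where f: "f \<in> S" "f * f = f" "rid ((1 - e) * y) = rid f"
    using rideal_idem[OF rid_rideals[OF b]] by metis
  obtain r where r: "r \<in> S" "f = (1 - e) * y * r"
    using f(3) rid_self[of f] by (auto simp: rid_def)
  have ef: "e * f = 0" unfolding r(2) using e(2) by (simp add: algebra_simps) (simp add: mult.assoc[symmetric])
  define g where "g = f * (1 - e)"
  have g: "g \<in> S" "g * g = g" "e * g = 0" "g * e = 0" "g * f = f" "f * g = g"
    using e f ef by (auto simp: g_def algebra_simps mult.assoc[symmetric] intro: mems)
  have h: "e + g \<in> S" "(e + g) * (e + g) = e + g"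
    using e g by (auto simp: algebra_simps intro: mems)
  have "psum A B = rid (e + g)"
  proof
    show "psum A B \<subseteq> rid (e + g)"
    proof
      fix z assume "z \<in> psum A B"
      then obtain a s where z: "a \<in> rid e" "s \<in> S" "z = a + y * s"
        by (auto simp: psum_def e(3) y(2) rid_def)
      then have a: "a \<in> S" "e * a = a" using mem_rid_idem[OF e(1,2)] by auto
      have "(1 - e) * y \<in> rid f" using f(3) rid_self by metis
      then have fy: "f * ((1 - e) * y) = (1 - e) * y" using mem_rid_idem[OF f(1,2)] by blast
      then have gy: "g * y = y - e * y"
        by (simp add: g_def mult.assoc left_diff_distrib)
      have "g * a = 0" using g(4) a(2) by (metis mult.assoc mult_zero_left)
      moreover have "g * (y * s) = y * s - e * (y * s)"
        by (simp add: mult.assoc[symmetric] gy left_diff_distrib)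
      ultimately have "(e + g) * z = z"
        using a(2) by (simp add: z(3) distrib_left distrib_right)
      then show "z \<in> rid (e + g)" using z a y mem_rid_idem[OF h] by (auto intro: mems)
    qed
    have gB: "g = y * (r * (1 - e)) - e * (y * (r * (1 - e)))"
      unfolding g_def r(2) by (simp add: algebra_simps)
    show "rid (e + g) \<subseteq> psum A B"
    proof
      fix z assume "z \<in> rid (e + g)"
      then obtain s where s: "s \<in> S" "z = (e + g) * s" by (auto simp: rid_def)
      have "z = e * (s - y * (r * (1 - e)) * s) + y * (r * (1 - e) * s)"
        unfolding s(2) gB by (simp add: distrib_right left_diff_distrib right_diff_distrib mult.assoc)
      moreover have "e * (s - y * (r * (1 - e)) * s) \<in> A" "y * (r * (1 - e) * s) \<in> B"
        unfolding e(3) y(2) rid_def using e y r s by (auto intro!: imageI mems)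
      ultimately show "z \<in> psum A B" by (auto intro: psumI)
    qed
  qed
  then show ?thesis using rid_rideals h(1) by simp
qed

text \<open>\<open>e * x\<close> lies in \<open>B\<close> exactly when
  \<open>(1 - f) * e * x = 0\<close>. For a quasi-inverse \<open>c\<close> of
  \<open>(1 - f) * e\<close>, the right annihilator of that element is generated by
  \<open>1 - c * ((1 - f) * e)\<close>; multiplying by \<open>e\<close> on the left gives the
  generator \<open>d\<close> of the intersection.\<close>

lemma Int_rideals:
  assumes "A \<in> rideals" "B \<in> rideals"
  shows "A \<inter> B \<in> rideals"
proof -
  obtain e where e: "e \<in> S" "e * e = e" "A = rid e" using assms(1) by (rule rideal_idem)
  obtain f where f: "f \<in> S" "f * f = f" "B = rid f" using assms(2) by (rule rideal_idem)
  have "(1 - f) * e \<in> S" using e f by (auto intro: mems)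
  then obtain c where c: "c \<in> S" "(1 - f) * e * c * ((1 - f) * e) = (1 - f) * e"
    using ex_quasi_inverse by blast
  define d where "d = e * (1 - c * ((1 - f) * e))"
  have d: "d \<in> S" "e * d = d"
    using c(1) e f by (auto simp: d_def mult.assoc[symmetric] intro!: mems)
  have "(1 - f) * d = (1 - f) * e - (1 - f) * e * c * ((1 - f) * e)"
    by (simp add: d_def algebra_simps)
  then have "f * d = d" using c(2) by (simp add: left_diff_distrib)
  then have "d \<in> A \<inter> B" using d e f mem_rid_idem by auto
  moreover have "x \<in> rid d" if "x \<in> A \<inter> B" for x
  proof -
    have x: "x \<in> S" "e * x = x" "f * x = x" using that e f mem_rid_idem by auto
    have "(1 - f) * e * x = 0" using x by (simp add: mult.assoc left_diff_distrib)
    then have "d * x = x" using x by (simp add: d_def mult.assoc left_diff_distrib right_diff_distrib)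
    then show ?thesis using x(1) by (metis imageI rid_def)
  qed
  ultimately have "A \<inter> B = rid d"
    using assms by (auto simp: rid_def intro: rideal_mult)
  then show ?thesis using rid_rideals d(1) by simp
qed

lemma psum_subset_iff:
  assumes "A \<in> rideals" "B \<in> rideals" "C \<in> rideals"
  shows "psum A B \<subseteq> C \<longleftrightarrow> A \<subseteq> C \<and> B \<subseteq> C"
  using rideal_zero[OF assms(1)] rideal_zero[OF assms(2)] rideal_add[OF assms(3)]
  unfolding psum_def by (force intro: exI[of _ 0])

lemma psum_upper:
  assumes "A \<in> rideals" "B \<in> rideals"
  shows "A \<subseteq> psum A B" "B \<subseteq> psum A B"
  using psum_subset_iff[OF assms psum_rideals[OF assms]] by auto

lemma psum_modular:
  assumes "A \<in> rideals" "B \<in> rideals" "C \<in> rideals" "A \<subseteq> C"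
  shows "psum A (B \<inter> C) = psum A B \<inter> C"
proof
  show "psum A (B \<inter> C) \<subseteq> psum A B \<inter> C"
    using assms rideal_add by (auto simp: psum_def)
  show "psum A B \<inter> C \<subseteq> psum A (B \<inter> C)"
  proof
    fix x assume "x \<in> psum A B \<inter> C"
    then obtain a b where x: "x = a + b" "a \<in> A" "b \<in> B" "x \<in> C" by (auto simp: psum_def)
    then have "b \<in> C" using rideal_diff[OF assms(3), of x a] assms(4) by auto
    then show "x \<in> psum A (B \<inter> C)" using x by (auto simp: psum_def)
  qed
qed

text \<open>For idempotents \<open>e\<close> and \<open>f\<close> generating \<open>A\<close> and
  \<open>B\<close>, every \<open>x\<close> in \<open>B\<close> splits as
  \<open>e * x + (f - e * f) * x\<close>, and \<open>e\<close> kills the second summand.\<close>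

lemma rideal_complement:
  assumes "A \<in> rideals" "B \<in> rideals" "A \<subseteq> B"
  obtains C where "C \<in> rideals" "C \<subseteq> B" "A \<inter> C = {0}" "psum A C = B"
proof -
  obtain e where e: "e \<in> S" "e * e = e" "A = rid e" using assms(1) by (rule rideal_idem)
  obtain f where f: "f \<in> S" "f * f = f" "B = rid f" using assms(2) by (rule rideal_idem)
  have fe: "f * e = e" using assms(3) e f rid_self[of e] mem_rid_idem by auto
  define d where "d = f - e * f"
  have d: "d \<in> S" "e * d = 0" "f * d = d" using e f fe
    by (auto simp: d_def right_diff_distrib mult.assoc[symmetric] intro: mems)
  have dB: "rid d \<subseteq> B" using d f mem_rid_idem rid_subset_iff[OF assms(2)] by auto
  show ?thesis
  proof
    show "rid d \<in> rideals" using d rid_rideals by simp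
    show "rid d \<subseteq> B" by fact
    have "x = 0" if "x \<in> A" "x \<in> rid d" for x
    proof -
      from that(2) obtain s where "x = d * s" by (auto simp: rid_def)
      moreover have "e * x = x" using that e mem_rid_idem by auto
      ultimately show ?thesis using d(2) by (metis mult.assoc mult_zero_left)
    qed
    then show "A \<inter> rid d = {0}"
      using rideal_zero assms(1) rid_rideals[OF d(1)] by blast
    have "psum A (rid d) \<subseteq> B"
      using psum_subset_iff[OF assms(1) rid_rideals[OF d(1)] assms(2)] dB assms(3) by simp
    moreover have "x \<in> psum A (rid d)" if "x \<in> B" for x
    proof -
      have x: "x \<in> S" "f * x = x" using that f mem_rid_idem by auto
      then have "x = e * x + d * x" by (simp add: d_def left_diff_distrib mult.assoc)
      then show ?thesis using x unfolding psum_def e(3) rid_def by blast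
    qed
    ultimately show "psum A (rid d) = B" by blast
  qed
qed

text \<open>\<open>g\<close> codes right ideals in another type, in the end \<open>nat set\<close>.
  The order refers to all of \<open>rideals\<close> and not to \<open>I\<close>, so restricting the
  carrier of the lattice of all ideals yields literally the smaller lattice.\<close>

definition ord_of :: "('a set \<Rightarrow> 'b) \<Rightarrow> 'a set set \<Rightarrow> 'b gorder" where
  "ord_of g I = \<lparr>carrier = g ` I, eq = (=),
     le = (\<lambda>x y. \<exists>A\<in>rideals. \<exists>B\<in>rideals. x = g A \<and> y = g B \<and> A \<subseteq> B)\<rparr>"

end

section \<open>Modular lattices given by an ideal in the lattice of principal right ideals\<close>

locale right_ideals = regular_subring S for S :: "'a::ring_1 set" +
  fixes g :: "'a set \<Rightarrow> 'b" and I :: "'a set set"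
  assumes inj: "inj_on g rideals"
    and I_rideals: "I \<subseteq> rideals"
    and I_zero: "{0} \<in> I"
    and I_down: "\<lbrakk>A \<in> I; B \<in> rideals; B \<subseteq> A\<rbrakk> \<Longrightarrow> B \<in> I"
    and I_psum: "\<lbrakk>A \<in> I; B \<in> I\<rbrakk> \<Longrightarrow> psum A B \<in> I"
begin

abbreviation "L \<equiv> ord_of g I"

lemma rideal_I: "A \<in> I \<Longrightarrow> A \<in> rideals" using I_rideals by blast

lemma carrier_L [simp]: "carrier L = g ` I"
  and eq_L [simp]: "eq L = (=)"
  by (simp_all add: ord_of_def)

lemma g_eq_iff: "\<lbrakk>A \<in> I; B \<in> I\<rbrakk> \<Longrightarrow> g A = g B \<longleftrightarrow> A = B"
  using inj rideal_I by (auto simp: inj_on_def)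

lemma le_L [simp]: "\<lbrakk>A \<in> I; B \<in> I\<rbrakk> \<Longrightarrow> g A \<sqsubseteq>\<^bsub>L\<^esub> g B \<longleftrightarrow> A \<subseteq> B"
  using inj rideal_I unfolding ord_of_def inj_on_def by simp blast

sublocale po: partial_order L
  by unfold_locales (auto simp: g_eq_iff)

lemma Int_I: "\<lbrakk>A \<in> I; B \<in> I\<rbrakk> \<Longrightarrow> A \<inter> B \<in> I"
  using I_down Int_rideals rideal_I by blast

lemma least_join:
  assumes "A \<in> I" "B \<in> I"
  shows "least L (g (psum A B)) (Upper L {g A, g B})"
  using assms psum_upper[of A B] psum_subset_iff[of A B]
  by (auto simp: least_def Upper_def rideal_I I_psum)

lemma greatest_meet:
  assumes "A \<in> I" "B \<in> I"
  shows "greatest L (g (A \<inter> B)) (Lower L {g A, g B})"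
  using assms by (auto simp: greatest_def Lower_def Int_I)

lemma join_L [simp]: "\<lbrakk>A \<in> I; B \<in> I\<rbrakk> \<Longrightarrow> g A \<squnion>\<^bsub>L\<^esub> g B = g (psum A B)"
  unfolding join_def by (rule sup_eqI[OF po.partial_order_axioms least_join])

lemma meet_L [simp]: "\<lbrakk>A \<in> I; B \<in> I\<rbrakk> \<Longrightarrow> g A \<sqinter>\<^bsub>L\<^esub> g B = g (A \<inter> B)"
  unfolding meet_def by (rule inf_eqI[OF po.partial_order_axioms greatest_meet])

lemma least_bottom: "least L (g {0}) (carrier L)"
  using rideal_zero rideal_I by (auto simp: least_def I_zero)

sublocale lat: modular_lattice_zero L
proof unfold_locales
  fix x y assume "x \<in> carrier L" "y \<in> carrier L"
  then show "\<exists>s. least L s (Upper L {x, y})" "\<exists>s. greatest L s (Lower L {x, y})"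
    by (auto intro: least_join greatest_meet)
next
  show "\<exists>x. least L x (carrier L)" using least_bottom by blast
next
  fix x y z assume "x \<in> carrier L" "y \<in> carrier L" "z \<in> carrier L" "x \<sqsubseteq>\<^bsub>L\<^esub> z"
  then show "x \<squnion>\<^bsub>L\<^esub> (y \<sqinter>\<^bsub>L\<^esub> z) = (x \<squnion>\<^bsub>L\<^esub> y) \<sqinter>\<^bsub>L\<^esub> z"
    using psum_modular by (auto simp: Int_I I_psum rideal_I)
qed

lemma bottom_L [simp]: "\<bottom>\<^bsub>L\<^esub> = g {0}"
  using lat.bottom_least least_bottom po.least_unique by blast

lemma sectionally_complemented: "sectionally_complemented_modular_lattice L"
proof unfold_locales
  fix a b assume "a \<in> carrier L" "b \<in> carrier L" "a \<sqsubseteq>\<^bsub>L\<^esub> b"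
  then obtain A B where AB: "A \<in> I" "B \<in> I" "A \<subseteq> B" "a = g A" "b = g B" by auto
  obtain C where C: "C \<in> rideals" "C \<subseteq> B" "A \<inter> C = {0}" "psum A C = B"
    using rideal_complement AB rideal_I by metis
  then have "C \<in> I" using I_down AB by blast
  then show "\<exists>x\<in>carrier L. is_direct_sum2 L a x b"
    using AB C by (intro bexI[of _ "g C"]) (auto simp: is_direct_sum2_def)
qed

lemma complemented:
  assumes "I = rideals"
  shows "complemented_modular_lattice L" "\<top>\<^bsub>L\<^esub> = g S"
proof -
  have S: "S \<in> I" using S_rideals assms by simp
  have gr: "greatest L (g S) (carrier L)"
    using S rideal_subset rideal_I by (auto simp: greatest_def)
  interpret weak_partial_order_top L
    by unfold_locales (use gr in blast)
  show top: "\<top>\<^bsub>L\<^esub> = g S"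
    using top_greatest gr po.greatest_unique by blast
  show "complemented_modular_lattice L"
  proof unfold_locales
    fix a assume "a \<in> carrier L"
    then obtain A where A: "A \<in> I" "a = g A" by auto
    obtain C where C: "C \<in> rideals" "A \<inter> C = {0}" "psum A C = S"
      using rideal_complement[of A S] A rideal_I S_rideals rideal_subset by metis
    then have "C \<in> I" using assms by simp
    then show "\<exists>x\<in>carrier L. is_direct_sum2 L a x \<top>\<^bsub>L\<^esub>"
      unfolding top using A C by (intro bexI[of _ "g C"]) (simp_all add: is_direct_sum2_def)
  qed
qed

section \<open>Orthogonal idempotents, independence and perspectivity\<close>

definition orthogonal_family :: "nat \<Rightarrow> (nat \<Rightarrow> 'a) \<Rightarrow> bool" where
  "orthogonal_family n e \<longleftrightarrow>
     (\<forall>i<n. e i \<in> S \<and> rid (e i) \<in> I) \<and> (\<forall>i<n. \<forall>j<n. e i * e j = (if i = j then e i else 0))"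

lemma orthogonal_family_sum:
  assumes "orthogonal_family n e" "k \<le> n"
  shows "(\<Sum>i<k. e i) \<in> S" "i < n \<Longrightarrow> e i * (\<Sum>i<k. e i) = (if i < k then e i else 0)"
    "i < n \<Longrightarrow> (\<Sum>i<k. e i) * e i = (if i < k then e i else 0)"
    "(\<Sum>i<k. e i) * (\<Sum>i<k. e i) = (\<Sum>i<k. e i)" "rid (\<Sum>i<k. e i) \<in> I"
proof -
  have e: "e i \<in> S" "rid (e i) \<in> I" if "i < n" for i
    using assms(1) that by (auto simp: orthogonal_family_def)
  have o: "e i * e j = (if i = j then e i else 0)" if "i < n" "j < n" for i j
    using assms(1) that by (auto simp: orthogonal_family_def)
  have S: "(\<Sum>i<k. e i) \<in> S" if "k \<le> n" for k using e that by (auto intro!: sum_mem)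
  then show "(\<Sum>i<k. e i) \<in> S" using assms(2) .
  have l: "e i * (\<Sum>i<k. e i) = (if i < k then e i else 0)" if "i < n" for i
    using assms(2) that by (simp add: sum_distrib_left o)
  then show "i < n \<Longrightarrow> e i * (\<Sum>i<k. e i) = (if i < k then e i else 0)" .
  show "i < n \<Longrightarrow> (\<Sum>i<k. e i) * e i = (if i < k then e i else 0)"
    using assms(2) by (simp add: sum_distrib_right o)
  show "(\<Sum>i<k. e i) * (\<Sum>i<k. e i) = (\<Sum>i<k. e i)"
    by (subst sum_distrib_right, rule sum.cong) (use assms(2) l in auto)
  show "rid (\<Sum>i<k. e i) \<in> I" using assms(2)
  proof (induction k)
    case 0 then show ?case using I_zero by (simp add: rid_zero)
  next
    case (Suc k)
    then have *: "rid (\<Sum>i<k. e i) \<in> I" "rid (e k) \<in> I" using e by auto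
    have "(\<Sum>i<Suc k. e i) \<in> psum (rid (\<Sum>i<k. e i)) (rid (e k))"
      using rid_self by (simp add: psumI)
    then have "rid (\<Sum>i<Suc k. e i) \<subseteq> psum (rid (\<Sum>i<k. e i)) (rid (e k))"
      using rid_subset_iff I_psum[OF *] rideal_I by blast
    then show ?case using I_down[OF I_psum[OF *]] rid_rideals[OF S[OF Suc.prems]] by blast
  qed
qed

text \<open>The sum of the idempotents fixes each \<open>e i\<close> from the left, so its right
  ideal lies above every \<open>rid (e i)\<close>; being a sum of the \<open>e i\<close>, it belongs
  to every right ideal that contains them all.\<close>

lemma sup_orthogonal_family:
  assumes "orthogonal_family n e" "k \<le> n"
  shows "\<Squnion>\<^bsub>L\<^esub> ((\<lambda>i. g (rid (e i))) ` {..<k}) = g (rid (\<Sum>i<k. e i))"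
proof (rule sup_eqI[OF po.partial_order_axioms])
  note s = orthogonal_family_sum[OF assms]
  have e: "e i \<in> S" "rid (e i) \<in> I" if "i < n" for i
    using assms(1) that by (auto simp: orthogonal_family_def)
  have ub: "rid (e i) \<subseteq> rid (\<Sum>i<k. e i)" if "i < k" for i
    using s(3)[of i] that assms(2) rid_mult_subset[OF s(1) e(1), of i] by simp
  have lb: "rid (\<Sum>i<k. e i) \<subseteq> C" if "C \<in> I" "\<forall>i<k. rid (e i) \<subseteq> C" for C
    using that rideal_sum[OF rideal_I, of C "{..<k}" e] rid_subset_iff[OF rideal_I, of C] by auto
  have le: "g (rid (e i)) \<sqsubseteq>\<^bsub>L\<^esub> g C \<longleftrightarrow> rid (e i) \<subseteq> C" if "i < k" "C \<in> I" for i C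
    using e that assms(2) by simp
  have "g (rid (\<Sum>i<k. e i)) \<in> Upper L ((\<lambda>i. g (rid (e i))) ` {..<k})"
  proof -
    have "g (rid (e i)) \<sqsubseteq>\<^bsub>L\<^esub> g (rid (\<Sum>i<k. e i))" if "i < k" for i
      using le[OF that s(5)] ub[OF that] by blast
    then show ?thesis using s(5) unfolding Upper_def by fastforce
  qed
  moreover have "g (rid (\<Sum>i<k. e i)) \<sqsubseteq>\<^bsub>L\<^esub> u" if u: "u \<in> Upper L ((\<lambda>i. g (rid (e i))) ` {..<k})" for u
  proof -
    obtain C where C: "C \<in> I" "u = g C" using u by (auto simp: Upper_def)
    have "rid (e i) \<subseteq> C" if "i < k" for i
      using u that e[of i] assms(2) le[OF that C(1)] by (auto simp: Upper_def C(2))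
    then show ?thesis using lb C s(5) by simp
  qed
  ultimately show "least L (g (rid (\<Sum>i<k. e i))) (Upper L ((\<lambda>i. g (rid (e i))) ` {..<k}))"
    by (auto simp: least_def Upper_def)
qed

lemma orthogonal_independent:
  assumes "orthogonal_family n e"
  shows "Defs.independent L n (\<lambda>i. g (rid (e i)))"
  unfolding Defs.independent_def
proof (intro conjI allI impI)
  fix k assume k: "k < n"
  have e: "e k \<in> S" "rid (e k) \<in> I" "e k * e k = e k"
    using assms k by (auto simp: orthogonal_family_def)
  note s = orthogonal_family_sum[OF assms less_imp_le[OF k]]
  show "g (rid (e k)) \<in> carrier L" using e by simp
  have "x = 0" if "x \<in> rid (e k)" "x \<in> rid (\<Sum>i<k. e i)" for x
  proof -
    have "e k * x = x" "(\<Sum>i<k. e i) * x = x" using that e s mem_rid_idem by auto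
    \<comment> \<open>Both idempotents fix \<open>x\<close>, and their product is zero by
      orthogonality.\<close>
    then have "x = e k * (\<Sum>i<k. e i) * x" by (simp add: mult.assoc)
    then show ?thesis using s(2)[OF k] by simp
  qed
  then have "rid (e k) \<inter> rid (\<Sum>i<k. e i) = {0}"
    using e s rideal_zero[OF rideal_I] by blast
  then show "g (rid (e k)) \<sqinter>\<^bsub>L\<^esub> \<Squnion>\<^bsub>L\<^esub> ((\<lambda>i. g (rid (e i))) ` {..<k}) = \<bottom>\<^bsub>L\<^esub>"
    using sup_orthogonal_family[OF assms less_imp_le[OF k]] e s by simp
qed

text \<open>The axis is the graph \<open>{v - x * v | v \<in> a}\<close> of the map \<open>x\<close> from \<open>a\<close> to \<open>f\<close>.\<close>

lemma graph_axis:
  assumes "a \<in> S" "f \<in> S" "x \<in> S" "f * f = f" "f * a = 0" "f * x = x" "rid a \<in> I" "rid f \<in> I"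
    and inj: "\<And>r. r \<in> S \<Longrightarrow> x * a * r = 0 \<Longrightarrow> a * r = 0"
  shows "rid (a - x * a) \<in> I" "subperspective_by L (g (rid (a - x * a))) (g (rid a)) (g (rid f))"
    and "(\<exists>y\<in>S. f = x * a * y) \<Longrightarrow> perspective_by L (g (rid (a - x * a))) (g (rid a)) (g (rid f))"
proof -
  let ?c = "a - x * a"
  have c: "?c \<in> S" using assms by (auto intro: mems)
  have xa: "x * a \<in> rid f" using assms mem_rid_idem by (auto simp: mult.assoc[symmetric] intro: mems)
  have "?c \<in> psum (rid a) (rid f)"
    using psumI[OF rid_self rideal_uminus[OF rid_rideals[OF assms(2)] xa]] by simp
  then have "rid ?c \<subseteq> psum (rid a) (rid f)"
    using rid_subset_iff I_psum assms rideal_I by blast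
  then show cI: "rid ?c \<in> I" using I_down I_psum assms rid_rideals[OF c] by blast
  \<comment> \<open>Since \<open>f\<close> annihilates \<open>a\<close> and fixes \<open>x\<close>,
    multiplying by \<open>f\<close> reads off the second coordinate of a point of the graph. On
    \<open>rid a\<close> this coordinate is zero, and injectivity of \<open>x\<close> on
    \<open>a\<close> makes the point vanish.\<close>
  have z: "y = 0" if "y \<in> rid a" "y \<in> rid ?c" for y
  proof -
    from that obtain r where r1: "y = a * r" by (auto simp: rid_def)
    from that obtain r' where r: "r' \<in> S" "y = ?c * r'" by (auto simp: rid_def)
    have "f * y = 0" using r1 assms(5) by (simp add: mult.assoc[symmetric])
    moreover have "f * y = - (x * a * r')"
      using r(2) assms(5,6) by (simp add: mult.assoc[symmetric] right_diff_distrib)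
    ultimately have "x * a * r' = 0" by simp
    with r inj show ?thesis by (simp add: left_diff_distrib)
  qed
  have z': "y = 0" if "y \<in> rid f" "y \<in> rid ?c" for y
  proof -
    from that obtain r' where r: "r' \<in> S" "y = ?c * r'" by (auto simp: rid_def)
    have "f * y = y" using that assms mem_rid_idem by auto
    moreover have "f * y = - (x * a * r')"
      using r(2) assms(5,6) by (simp add: mult.assoc[symmetric] right_diff_distrib)
    ultimately have "a * r' = 0" using r(2) by (simp add: left_diff_distrib)
    with r(2) show ?thesis by (simp add: left_diff_distrib mult.assoc)
  qed
  have m: "rid a \<inter> rid ?c = {0}" "rid f \<inter> rid ?c = {0}"
    using z z' rideal_zero[OF rideal_I] assms cI by blast+
  have P: "rid a \<in> rideals" "rid f \<in> rideals" "rid ?c \<in> rideals" using assms cI rideal_I by auto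
  note ub = psum_upper[OF P(2) P(3)]
  have "a \<in> psum (rid f) (rid ?c)"
    using psumI[OF xa rid_self[of ?c]] by simp
  then have le: "psum (rid a) (rid ?c) \<subseteq> psum (rid f) (rid ?c)"
    using psum_subset_iff[OF P(1,3) psum_rideals[OF P(2,3)]] rid_subset_iff[OF psum_rideals[OF P(2,3)], of a] ub
    by simp
  show "subperspective_by L (g (rid ?c)) (g (rid a)) (g (rid f))"
    using m le cI assms by (simp add: subperspective_by_def I_psum)
  assume "\<exists>y\<in>S. f = x * a * y"
  then obtain y where y: "y \<in> S" "f = x * a * y" by blast
  have "f \<in> psum (rid a) (rid ?c)"
  proof -
    \<comment> \<open>Subtracting from \<open>v = a * y\<close> its graph point
      \<open>v - x * v\<close> leaves \<open>x * v = f\<close>.\<close>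
    have "a * y \<in> rid a" "?c * (- y) \<in> rid ?c" unfolding rid_def
      by (intro imageI y(1) uminus_mem)+
    then have "a * y + ?c * (- y) \<in> psum (rid a) (rid ?c)" by (rule psumI)
    moreover have "a * y + ?c * (- y) = f" by (simp add: y(2) algebra_simps)
    ultimately show ?thesis by simp
  qed
  then have "psum (rid f) (rid ?c) \<subseteq> psum (rid a) (rid ?c)"
    using psum_subset_iff[OF P(2,3) psum_rideals[OF P(1,3)]] rid_subset_iff[OF psum_rideals[OF P(1,3)], of f]
      psum_upper[OF P(1,3)]
    by simp
  with le show "perspective_by L (g (rid ?c)) (g (rid a)) (g (rid f))"
    using m cI assms by (simp add: perspective_by_def)
qed

end

section \<open>Subrings as records, and small regular subrings\<close>

definition subring_record :: "'a::ring_1 set \<Rightarrow> 'a ring" where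
  "subring_record S = \<lparr>carrier = S, mult = (*), one = 1, zero = 0, add = (+)\<rparr>"

lemma (in regular_subring) regular_ring_subring_record: "regular_ring (subring_record S)"
proof -
  interpret abelian_group "subring_record S"
    by (rule abelian_groupI)
      (auto simp: subring_record_def algebra_simps intro: mems intro!: bexI[of _ "- x" for x])
  show ?thesis
    by unfold_locales (use ex_quasi_inverse in \<open>auto simp: subring_record_def algebra_simps intro: mems\<close>)
qed

lemma (in regular_subring) right_ideal_lattice_subring_record:
  "carrier (right_ideal_lattice (subring_record S)) = rideals"
  by (auto simp: right_ideal_lattice_def subring_record_def l_coset_def rideals_def rid_def image_def)

text \<open>A downward Loewenheim-Skolem argument: \<open>insert 1 X\<close> is closed under the
  ring operations and a fixed choice of quasi-inverses, which \<open>gen_card\<close> shows not to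
  exceed the infinite bound.\<close>

lemma small_regular_subring:
  fixes A X :: "'a::ring_1 set" and U :: "'u set"
  assumes "regular_subring A" "X \<subseteq> A" "infinite U" "|X| \<le>o |U|"
  obtains S where "regular_subring S" "X \<subseteq> S" "S \<subseteq> A" "|S| \<le>o |U|"
proof -
  interpret regular_subring A by fact
  define R where "R = subring_record A"
  interpret R: regular_ring R unfolding R_def by (rule regular_ring_subring_record)
  have ops [simp]: "carrier R = A" "x \<otimes>\<^bsub>R\<^esub> y = x * y" "x \<oplus>\<^bsub>R\<^esub> y = x + y" "\<zero>\<^bsub>R\<^esub> = 0" for x y
    by (simp_all add: R_def subring_record_def)
  have neg: "\<ominus>\<^bsub>R\<^esub> x = - x" if "x \<in> A" for x
    using that R.minus_equality[of "- x" x] by (simp add: uminus_mem)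
  define S where "S = R.gen (insert 1 X)"
  have SA: "S \<subseteq> A"
    unfolding S_def using R.gen_carrier[of "insert 1 X"] assms(2) one_mem by simp
  have gadd: "x + y \<in> S" and gmult: "x * y \<in> S" if "x \<in> S" "y \<in> S" for x y
    using R.gen.add[of x "insert 1 X" y] R.gen.mult[of x "insert 1 X" y] that by (simp_all add: S_def)
  have gneg: "- x \<in> S" if "x \<in> S" for x
    using R.gen.neg[of x "insert 1 X"] that SA neg[of x] by (auto simp: S_def)
  have "regular_subring S"
  proof
    show "1 \<in> S" by (simp add: S_def R.gen.base)
    show "x - y \<in> S" if "x \<in> S" "y \<in> S" for x y
      using gadd[OF that(1) gneg[OF that(2)]] by simp
    show "\<exists>y\<in>S. x * y * x = x" if "x \<in> S" for x
      using R.gen.qi[of x "insert 1 X"] R.qinv[of x] that SA by (auto simp: S_def)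
  qed (rule gmult)
  moreover have "X \<subseteq> S" by (auto simp: S_def intro: R.gen.base)
  moreover have "|insert 1 X| \<le>o |U|"
  proof -
    have "|{1::'a}| \<le>o |U|" using assms(3) by (intro card_of_singl_ordLeq) auto
    then have "|{1} \<union> X| \<le>o |U|"
      by (rule card_of_Un_ordLeq_infinite_Field[rotated])
        (use assms in \<open>simp_all add: Field_card_of card_of_card_order_on\<close>)
    then show ?thesis by simp
  qed
  then have "|S| \<le>o |U|" unfolding S_def by (rule R.gen_card[OF assms(3)])
  ultimately show ?thesis using that SA by blast
qed

section \<open>Idempotents of regular rings without unit\<close>

context nonunital_ring
begin

lemma eq_minus_iff:
  assumes "a \<in> carrier R" "b \<in> carrier R" "c \<in> carrier R"
  shows "a \<oplus> b = c \<longleftrightarrow> a = c \<ominus> b"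
  using assms by (auto simp: a_minus_def a_assoc l_neg r_neg)

lemma minus_distr:
  assumes "x \<in> carrier R" "y \<in> carrier R" "z \<in> carrier R"
  shows "(x \<ominus> y) \<otimes> z = x \<otimes> z \<ominus> y \<otimes> z" "z \<otimes> (x \<ominus> y) = z \<otimes> x \<ominus> z \<otimes> y"
proof -
  have e: "x \<ominus> y \<in> carrier R" "(x \<ominus> y) \<oplus> y = x" using assms eq_minus_iff[of "x \<ominus> y" y x] by auto
  have "(x \<ominus> y) \<otimes> z \<oplus> y \<otimes> z = x \<otimes> z" using l_distr[OF e(1) assms(2,3)] e(2) by simp
  then show "(x \<ominus> y) \<otimes> z = x \<otimes> z \<ominus> y \<otimes> z"
    using assms e eq_minus_iff[of "(x \<ominus> y) \<otimes> z" "y \<otimes> z" "x \<otimes> z"] by (simp add: m_closed)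
  have "z \<otimes> (x \<ominus> y) \<oplus> z \<otimes> y = z \<otimes> x" using r_distr[OF e(1) assms(2,3)] e(2) by simp
  then show "z \<otimes> (x \<ominus> y) = z \<otimes> x \<ominus> z \<otimes> y"
    using assms e eq_minus_iff[of "z \<otimes> (x \<ominus> y)" "z \<otimes> y" "z \<otimes> x"] by (simp add: m_closed)
qed

lemma minus_self: "x \<in> carrier R \<Longrightarrow> x \<ominus> x = \<zero>"
  by (simp add: a_minus_def r_neg)

lemma null_mult: "x \<in> carrier R \<Longrightarrow> \<zero> \<otimes> x = \<zero>" "x \<in> carrier R \<Longrightarrow> x \<otimes> \<zero> = \<zero>"
  using minus_distr[of \<zero> \<zero> x] minus_self[of \<zero>] minus_self m_closed by auto

end

context regular_ring
begin

lemma mult_mem_principal: "s \<in> carrier R \<Longrightarrow> x \<otimes> s \<in> x <# carrier R"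
  by (auto simp: l_coset_def)

lemma principal_idem:
  assumes "x \<in> carrier R"
  obtains e where "e \<in> carrier R" "e \<otimes> e = e" "x <# carrier R = e <# carrier R"
proof -
  have c: "qinv x \<in> carrier R" "x \<otimes> qinv x \<in> carrier R" using assms qinv m_closed by auto
  have e: "x \<otimes> qinv x \<otimes> (x \<otimes> qinv x) = x \<otimes> qinv x"
    using assms c qinv(2)[OF assms] m_assoc[of "x \<otimes> qinv x" x "qinv x"] by simp
  have "x <# carrier R = (x \<otimes> qinv x) <# carrier R"
  proof
    show "x <# carrier R \<subseteq> (x \<otimes> qinv x) <# carrier R"
      unfolding l_coset_def using assms c qinv(2)[OF assms]
      by (clarsimp) (metis m_assoc m_closed)
    show "(x \<otimes> qinv x) <# carrier R \<subseteq> x <# carrier R"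
      unfolding l_coset_def using assms c by (auto simp: m_assoc intro: m_closed)
  qed
  with that c e show ?thesis by blast
qed

lemma mem_idem_iff:
  assumes "e \<in> carrier R" "e \<otimes> e = e"
  shows "y \<in> e <# carrier R \<longleftrightarrow> y \<in> carrier R \<and> e \<otimes> y = y"
proof
  assume "y \<in> e <# carrier R"
  then obtain r where "r \<in> carrier R" "y = e \<otimes> r" by (auto simp: l_coset_def)
  then show "y \<in> carrier R \<and> e \<otimes> y = y"
    using assms m_closed m_assoc[of e e r] by simp
next
  assume "y \<in> carrier R \<and> e \<otimes> y = y"
  then show "y \<in> e <# carrier R" unfolding l_coset_def by force
qed

text \<open>Without a unit, \<open>h - e h\<close> replaces \<open>1 - e\<close>: on the right ideal
  of \<open>h\<close> it acts as \<open>r\<close> to \<open>r - e r\<close>, the projection along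
  \<open>e\<close> onto the right annihilator of \<open>e\<close>.\<close>

lemma principal_annihilator:
  assumes e: "e \<in> carrier R" "e \<otimes> e = e" and h: "h \<in> carrier R" "h \<otimes> h = h" and "h \<otimes> e = e"
  obtains k where "k \<in> carrier R" "k <# carrier R = {r \<in> h <# carrier R. e \<otimes> r = \<zero>}"
    "\<forall>r\<in>h <# carrier R. r \<ominus> e \<otimes> r \<in> k <# carrier R"
proof
  let ?k = "h \<ominus> e \<otimes> h"
  show k: "?k \<in> carrier R" using e h m_closed by simp
  have act: "?k \<otimes> r = r \<ominus> e \<otimes> r" if "r \<in> h <# carrier R" for r
  proof -
    have r: "r \<in> carrier R" "h \<otimes> r = r" using that mem_idem_iff[OF h] by auto
    then show ?thesis
      using minus_distr(1)[OF h(1) m_closed[OF e(1) h(1)] r(1)] m_assoc[OF e(1) h(1) r(1)] by simp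
  qed
  have mem: "r \<ominus> e \<otimes> r \<in> ?k <# carrier R" if "r \<in> h <# carrier R" for r
  proof -
    have "?k \<otimes> r \<in> ?k <# carrier R" using that mem_idem_iff[OF h] by (intro mult_mem_principal) auto
    then show ?thesis using act[OF that] by simp
  qed
  then show "\<forall>r\<in>h <# carrier R. r \<ominus> e \<otimes> r \<in> ?k <# carrier R" by blast
  have eh: "e \<otimes> h \<in> carrier R" using e h m_closed by simp
  have "e \<otimes> (e \<otimes> h) = e \<otimes> h" "h \<otimes> (e \<otimes> h) = e \<otimes> h"
    using m_assoc[of e e h] m_assoc[of h e h] e h assms(5) by simp_all
  then have ek: "e \<otimes> ?k = \<zero>" and hk: "h \<otimes> ?k = ?k"
    using minus_distr(2)[OF h(1) eh e(1)] minus_distr(2)[OF h(1) eh h(1)] minus_self[OF eh] h(2)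
    by simp_all
  show "?k <# carrier R = {r \<in> h <# carrier R. e \<otimes> r = \<zero>}"
  proof safe
    fix r assume "r \<in> ?k <# carrier R"
    then obtain s where s: "s \<in> carrier R" "r = ?k \<otimes> s" by (auto simp: l_coset_def)
    show "e \<otimes> r = \<zero>" using s k e ek m_assoc[of e ?k s] null_mult by simp
    show "r \<in> h <# carrier R"
      using s k h hk m_assoc[of h ?k s] m_closed mem_idem_iff[OF h] by simp
  next
    fix r assume r: "r \<in> h <# carrier R" "e \<otimes> r = \<zero>"
    then have "r \<ominus> e \<otimes> r = r" using mem_idem_iff[OF h] by (simp add: a_minus_def)
    then show "r \<in> ?k <# carrier R" using mem[OF r(1)] by simp
  qed
qed

text \<open>The left ideals of \<open>f\<close> and \<open>g\<close> lie in the left ideal of one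
  idempotent, the mirror image of \<open>psum_rideals\<close>. What matters later is that the right
  annihilator of \<open>e\<close> is then contained in those of \<open>f\<close> and
  \<open>g\<close>.\<close>

lemma ex_common_right_unit:
  assumes "f \<in> carrier R" "f \<otimes> f = f" "g \<in> carrier R"
  obtains e where "e \<in> carrier R" "e \<otimes> e = e" "f \<otimes> e = f" "g \<otimes> e = g"
proof -
  \<comment> \<open>The part of \<open>g\<close> outside the left ideal of \<open>f\<close>. The
    idempotent \<open>d\<close> is a right unit for it, and \<open>b\<close> corrects
    \<open>d\<close> so that \<open>f\<close> annihilates \<open>b\<close> from the left.\<close>
  define c where "c = g \<ominus> g \<otimes> f"
  have c: "c \<in> carrier R" using assms m_closed by (simp add: c_def)
  have cf: "c \<otimes> f = \<zero>"
    using assms m_closed m_assoc[of g f f] minus_distr(1)[of g "g \<otimes> f" f] minus_self by (simp add: c_def)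
  define d where "d = qinv c \<otimes> c"
  have q: "qinv c \<in> carrier R" "c \<otimes> qinv c \<otimes> c = c" using qinv[OF c] by auto
  have d: "d \<in> carrier R" "c \<otimes> d = c" using q c m_closed m_assoc by (auto simp: d_def)
  define b where "b = d \<ominus> f \<otimes> d"
  have b: "b \<in> carrier R" using d assms m_closed by (simp add: b_def)
  have fb: "f \<otimes> b = \<zero>"
    using assms d m_closed m_assoc[of f f d] minus_distr(2)[of d "f \<otimes> d" f] minus_self by (simp add: b_def)
  have "c \<otimes> (f \<otimes> d) = \<zero>"
    using assms d c cf m_assoc[of c f d, symmetric] null_mult(1)[OF d(1)] by simp
  then have cb: "c \<otimes> b = c"
    using assms d c m_closed minus_distr(2)[of d "f \<otimes> d" c] by (simp add: b_def a_minus_def)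
  let ?e = "f \<oplus> b"
  have e: "?e \<in> carrier R" using assms b by simp
  have fe: "f \<otimes> ?e = f" using r_distr[of f b f] assms b fb by simp
  have ce: "c \<otimes> ?e = c" using r_distr[of f b c] assms b c cf cb by simp
  have "d \<otimes> ?e = d" using ce q c e m_assoc[of "qinv c" c ?e] by (simp add: d_def)
  then have be: "b \<otimes> ?e = b"
    using minus_distr(1)[of d "f \<otimes> d" ?e] assms d e m_assoc[of f d ?e] m_closed by (simp add: b_def)
  have gc: "g = c \<oplus> g \<otimes> f"
    using eq_minus_iff[of c "g \<otimes> f" g] assms c m_closed by (simp add: c_def)
  have "g \<otimes> ?e = g"
    using l_distr[of c "g \<otimes> f" ?e] c assms e ce fe m_assoc[of g f ?e] m_closed gc by simp
  moreover have "?e \<otimes> ?e = ?e" using l_distr[of f b ?e] assms b e fe be by simp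
  ultimately show ?thesis using that e fe by blast
qed

end

section \<open>The first uncountable ordinal\<close>

text \<open>\<open>cardSuc natLeq\<close> is a well-order on certain sets of natural numbers, so
  \<open>Rep_w1\<close> embeds the new type into \<open>nat set\<close>; this is how the final
  lattices come to have carriers in that type.\<close>

typedef w1 = "Field (cardSuc natLeq)"
  using Field_cardSuc_not_empty natLeq_Card_order by blast

lemma Card_order_w1: "Card_order (cardSuc natLeq)"
  by (simp add: cardSuc_Card_order natLeq_Card_order)

lemma card_w1: "|UNIV :: w1 set| =o cardSuc natLeq"
proof -
  have "bij_betw Rep_w1 UNIV (Field (cardSuc natLeq))"
    using Rep_w1 Rep_w1_inject type_definition.Rep_range[OF type_definition_w1]
    by (simp add: bij_betw_def inj_on_def)
  then have "|UNIV :: w1 set| =o |Field (cardSuc natLeq)|" by (rule card_of_ordIsoI)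
  then show ?thesis using card_of_Field_ordIso[OF Card_order_w1] ordIso_transitive by blast
qed

lemma natLeq_less_w1: "natLeq <o |UNIV :: w1 set|"
  using cardSuc_greater[OF natLeq_Card_order] card_w1 ordIso_symmetric ordLess_ordIso_trans by blast

lemma uncountable_w1: "uncountable (UNIV :: w1 set)"
  using natLeq_less_w1 not_ordLess_ordLeq by (auto simp: countable_card_le_natLeq)

instantiation w1 :: linorder
begin

definition "x \<le> y \<longleftrightarrow> (Rep_w1 x, Rep_w1 y) \<in> cardSuc natLeq"
definition "x < y \<longleftrightarrow> x \<le> y \<and> x \<noteq> (y :: w1)"

instance
proof -
  have wo: "Linear_order (cardSuc natLeq)"
    using Card_order_w1 by (auto simp: card_order_on_def well_order_on_def)
  then have r: "refl_on (Field (cardSuc natLeq)) (cardSuc natLeq)" "trans (cardSuc natLeq)"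
      "antisym (cardSuc natLeq)" "total_on (Field (cardSuc natLeq)) (cardSuc natLeq)"
    by (auto simp: order_on_defs)
  have refl: "x \<le> x" for x :: w1 using r(1) Rep_w1 by (auto simp: less_eq_w1_def refl_on_def)
  have anti: "x \<le> y \<Longrightarrow> y \<le> x \<Longrightarrow> x = y" for x y :: w1
    by (metis Rep_w1_inject antisymD less_eq_w1_def r(3))
  show "OFCLASS(w1, linorder_class)"
  proof
    show "x < y \<longleftrightarrow> x \<le> y \<and> \<not> y \<le> x" for x y :: w1
      using anti refl by (auto simp: less_w1_def)
    show "x \<le> y \<Longrightarrow> y \<le> z \<Longrightarrow> x \<le> z" for x y z :: w1
      using r(2) by (auto simp: less_eq_w1_def dest: transD)
    show "x \<le> y \<or> y \<le> x" for x y :: w1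
      using r(4) Rep_w1 refl by (cases "x = y") (auto simp: less_eq_w1_def total_on_def Rep_w1_inject)
  qed (fact refl anti)+
qed

end

lemma countable_less_w1: "countable {y. y < (x :: w1)}"
proof -
  have "Rep_w1 ` {y. y < x} \<subseteq> underS (cardSuc natLeq) (Rep_w1 x)"
    by (auto simp: underS_def less_w1_def less_eq_w1_def Rep_w1_inject)
  then have "|{y. y < x}| \<le>o |underS (cardSuc natLeq) (Rep_w1 x)|"
    unfolding card_of_ordLeq[symmetric] using Rep_w1_inject by (meson inj_onI)
  also have "|underS (cardSuc natLeq) (Rep_w1 x)| <o cardSuc natLeq"
    by (rule card_of_underS[OF Card_order_w1 Rep_w1])
  finally have "|{y. y < x}| \<le>o natLeq"
    using cardSuc_ordLeq_ordLess[OF natLeq_Card_order card_of_Card_order] by blast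
  then show ?thesis by (simp add: countable_card_le_natLeq)
qed

text \<open>A countable cofinal \<open>K\<close> would make \<open>w1\<close> a countable union of
  countable initial segments.\<close>

lemma countable_bounded_w1:
  fixes K :: "w1 set"
  assumes "countable K"
  obtains b where "\<And>k. k \<in> K \<Longrightarrow> k < b"
proof (rule ccontr)
  assume "\<not> thesis"
  then have "\<forall>b. \<exists>k\<in>K. b \<le> k" using that by (meson linorder_not_less)
  then have "UNIV = (\<Union>k\<in>K. insert k {y. y < k})" by (fastforce simp: order.order_iff_strict)
  moreover have "countable (\<Union>k\<in>K. insert k {y. y < k})"
    using assms countable_less_w1 by auto
  ultimately show False using uncountable_w1 by simp
qed

text \<open>Countably many points of an infinite union appear at countably many stages. These stages
  have a common bound, at which the set would already be infinite.\<close>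

lemma finite_Union_w1_chain:
  fixes N :: "w1 \<Rightarrow> 'p set"
  assumes fin: "\<And>b. finite (N b)" and mono: "\<And>b c. b \<le> c \<Longrightarrow> N b \<subseteq> N c"
  shows "finite (\<Union>b. N b)"
proof (rule ccontr)
  assume "infinite (\<Union>b. N b)"
  then obtain p :: "nat \<Rightarrow> 'p" where p: "inj p" "range p \<subseteq> (\<Union>b. N b)"
    using infinite_countable_subset by blast
  then have "\<forall>n. \<exists>b. p n \<in> N b" by blast
  then obtain f where f: "\<And>n. p n \<in> N (f n)" by metis
  obtain b where "\<And>k. k \<in> range f \<Longrightarrow> k < b" by (rule countable_bounded_w1[of "range f"]) auto
  then have "range p \<subseteq> N b" using f mono by (metis image_subset_iff less_imp_le rangeI subsetD)
  then show False using fin p(1) finite_subset range_inj_infinite by blast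
qed

section \<open>Endomorphisms of a vector space of infinite dimension\<close>

type_synonym vec = "bool \<Rightarrow> nat \<Rightarrow> real"

definition vscale :: "real \<Rightarrow> vec \<Rightarrow> vec" where
  "vscale c v = (\<lambda>b n. c * v b n)"

interpretation vec: vector_space vscale
  by unfold_locales (auto simp: vscale_def fun_eq_iff algebra_simps)

interpretation vec: vector_space_pair vscale vscale ..

typedef endo = "{f :: vec \<Rightarrow> vec. Vector_Spaces.linear vscale vscale f}"
  morphisms app Endo
proof
  show "id \<in> {f :: vec \<Rightarrow> vec. Vector_Spaces.linear vscale vscale f}"
    using vec.linear_id by simp
qed

lemma linear_iff_vscale:
  "Vector_Spaces.linear vscale vscale f \<longleftrightarrow>
     (\<forall>u v. f (u + v) = f u + f v) \<and> (\<forall>c v. f (vscale c v) = vscale c (f v))"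
  unfolding Vector_Spaces.linear_iff using vec.vector_space_axioms by simp

lemma app_add [simp]: "app t (u + v) = app t u + app t v"
  and app_vscale [simp]: "app t (vscale c v) = vscale c (app t v)"
  using app[of t] by (auto simp: linear_iff_vscale)

lemma endo_eqI: "(\<And>v. app s v = app t v) \<Longrightarrow> s = t"
  by (metis app_inject ext)

lemma app_Endo:
  assumes "\<And>u v. f (u + v) = f u + f v" "\<And>c v. f (vscale c v) = vscale c (f v)"
  shows "app (Endo f) = f"
  by (rule Endo_inverse) (use assms linear_iff_vscale in simp)

instantiation endo :: ring_1
begin

definition "0 = Endo (\<lambda>v. 0)"
definition "1 = Endo (\<lambda>v. v)"
definition "s + t = Endo (\<lambda>v. app s v + app t v)"
definition "s - t = Endo (\<lambda>v. app s v - app t v)"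
definition "- t = Endo (\<lambda>v. - app t v)"
definition "s * t = Endo (\<lambda>v. app s (app t v))"

lemma app_ring [simp]: "app 0 v = 0" "app 1 v = v" "app (s + t) v = app s v + app t v"
  "app (s - t) v = app s v - app t v" "app (- t) v = - app t v" "app (s * t) v = app s (app t v)"
  unfolding zero_endo_def one_endo_def plus_endo_def minus_endo_def uminus_endo_def times_endo_def
  by (subst app_Endo; simp add: vec.scale_right_distrib vec.scale_right_diff_distrib)+

instance
proof
  show "(0::endo) \<noteq> 1"
  proof
    assume "(0::endo) = 1"
    then have "app 0 1 = app 1 1" by simp
    then show False by (simp add: fun_eq_iff)
  qed
qed (auto intro!: endo_eqI simp: algebra_simps)

end

text \<open>A linear map that inverts \<open>t\<close> on its range is a quasi-inverse of
  \<open>t\<close>.\<close>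

lemma endo_quasi_inverse: "\<exists>t'. t * t' * t = (t :: endo)"
proof -
  obtain g where g: "Vector_Spaces.linear vscale vscale g" "\<And>v. app t (g (app t v)) = app t v"
    using vec.linear_exists_right_inverse_on[of "app t" UNIV] app[of t] by auto
  then have "app (Endo g) = g" using Endo_inverse by blast
  then show ?thesis using g(2) by (auto intro!: exI[of _ "Endo g"] endo_eqI)
qed

text \<open>Vectors with index \<open>True\<close> span the space \<open>X\<close>, those with index \<open>False\<close> the space
  \<open>Y\<close>; \<open>xpart\<close> and \<open>xskew\<close> are two projections onto \<open>X\<close> with distinct kernels \<open>Y\<close> and the
  diagonal.\<close>

definition "xpart = Endo (\<lambda>v b n. if b then v True n else 0)"
definition "toX = Endo (\<lambda>v b n. if b then v False n else 0)"
definition "toY = Endo (\<lambda>v b n. if b then 0 else v True n)"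
definition "xskew = xpart - toX"

lemma app_xpart: "app xpart v b n = (if b then v True n else 0)"
  unfolding xpart_def by (subst app_Endo) (auto simp: vscale_def fun_eq_iff)

lemma app_toX: "app toX v b n = (if b then v False n else 0)"
  unfolding toX_def by (subst app_Endo) (auto simp: vscale_def fun_eq_iff)

lemma app_toY: "app toY v b n = (if b then 0 else v True n)"
  unfolding toY_def by (subst app_Endo) (auto simp: vscale_def fun_eq_iff)

lemma app_xskew: "app xskew v b n = (if b then v True n - v False n else 0)"
  by (simp add: xskew_def app_xpart app_toX)

text \<open>\<open>h n\<close> names the coordinate copied to position \<open>n\<close>, with
  \<open>None\<close> for zero. Acting alike on both copies makes these maps commute with
  \<open>xpart\<close> and \<open>xskew\<close>.\<close>

definition reindex :: "(nat \<Rightarrow> nat option) \<Rightarrow> endo" where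
  "reindex h = Endo (\<lambda>v b n. case h n of None \<Rightarrow> 0 | Some m \<Rightarrow> v b m)"

lemma app_reindex: "app (reindex h) v b n = (case h n of None \<Rightarrow> 0 | Some m \<Rightarrow> v b m)"
  unfolding reindex_def by (subst app_Endo) (auto simp: vscale_def fun_eq_iff split: option.split)

lemma reindex_mult: "reindex h * reindex k = reindex (\<lambda>n. Option.bind (h n) k)"
  by (rule endo_eqI) (auto simp: fun_eq_iff app_reindex split: option.split)

lemma reindex_xpart: "reindex h * xpart = xpart * reindex h"
  and reindex_xskew: "reindex h * xskew = xskew * reindex h"
  by (rule endo_eqI; auto simp: fun_eq_iff app_reindex app_xpart app_xskew split: option.split)+

lemma matrix_units: "xpart * xpart = xpart" "toX * toX = 0" "toX * toY = xpart" "toY * toX = 1 - xpart"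
  "xpart * toX = toX" "toX * xpart = 0" "toY * xpart = toY" "xpart * toY = 0" 
  by (rule endo_eqI; auto simp: fun_eq_iff app_xpart app_toX app_toY)+

lemma xskew_idem: "xskew * xskew = xskew"
  by (rule endo_eqI) (auto simp: fun_eq_iff app_xskew)

text \<open>The two kernels, Y and the diagonal, meet in zero.\<close>

lemma xpart_xskew_joint_kernel:
  assumes "xpart * t = 0" "xskew * t = 0"
  shows "t = 0"
proof (rule endo_eqI)
  fix v
  have "app (xpart * t) v True n = 0" "app (xskew * t) v True n = 0" for n
    using assms by simp_all
  then have "app t v True n = 0" "app t v False n = 0" for n
    by (auto simp: app_xpart app_xskew)
  then show "app t v = app 0 v" by (auto simp: fun_eq_iff) (metis (full_types))
qed

lemma commuting_quasi_inverse:
  fixes p t :: "'a::ring_1"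
  assumes "p * p = p" "t * p = p * t" "t * q * t = t"
  defines "t' \<equiv> p * q * p + (1 - p) * q * (1 - p)"
  shows "t * t' * t = t" "t' * p = p * t'"
proof -
  have c: "t * (1 - p) = (1 - p) * t" using assms(2) by (simp add: algebra_simps)
  have "t * t' * t = (t * p) * q * (p * t) + (t * (1 - p)) * q * ((1 - p) * t)"
    by (simp add: t'_def distrib_left distrib_right mult.assoc)
  also have "(t * p) * q * (p * t) = p * (t * q * t) * p"
    by (metis assms(2) mult.assoc)
  also have "(t * (1 - p)) * q * ((1 - p) * t) = (1 - p) * (t * q * t) * (1 - p)"
    by (metis c mult.assoc)
  also have "p * (t * q * t) * p + (1 - p) * (t * q * t) * (1 - p) = t"
    unfolding assms(3) assms(2)[symmetric] c[symmetric]
    using assms(1) by (simp add: mult.assoc algebra_simps)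
  finally show "t * t' * t = t" .
  show "t' * p = p * t'"
    using assms(1) by (simp add: t'_def algebra_simps) (simp add: mult.assoc[symmetric] assms(1))
qed

text \<open>An element that commutes with both projections is a diagonal matrix \<open>diag(a, a)\<close>.\<close>

lemma endo_commuting_quasi_inverse:
  "\<exists>t'. t * t' * t = t \<and> (t * xpart = xpart * t \<longrightarrow> t' * xpart = xpart * t')
     \<and> (t * xskew = xskew * t \<longrightarrow> t' * xskew = xskew * t')"
proof -
  obtain q where q: "t * q * t = t" using endo_quasi_inverse by blast
  consider (both) "t * xpart = xpart * t" "t * xskew = xskew * t" | (x) "t * xskew \<noteq> xskew * t" "t * xpart = xpart * t"
    | (s) "t * xpart \<noteq> xpart * t" "t * xskew = xskew * t"
    | (none) "t * xpart \<noteq> xpart * t" "t * xskew \<noteq> xskew * t" by blast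
  then show ?thesis
  proof cases
    case both
    then have tX: "t * toX = toX * t" by (simp add: xskew_def algebra_simps)
    \<comment> \<open>Commuting with \<open>toX\<close> passes on to \<open>toY\<close> through
      \<open>toX * toY = xpart\<close> and \<open>toY * toX = 1 - xpart\<close>.\<close>
    have "toY * t = toY * t * (toX * toY) + 0"
      by (simp add: matrix_units mult.assoc both) (simp add: mult.assoc[symmetric] matrix_units)
    also have "\<dots> = toY * (t * toX) * toY" by (simp add: mult.assoc)
    also have "\<dots> = (1 - xpart) * t * toY" by (simp add: tX mult.assoc[symmetric] matrix_units)
    also have "\<dots> = t * ((1 - xpart) * toY)" using both(1) by (simp add: algebra_simps) (simp add: mult.assoc[symmetric])
    also have "\<dots> = t * toY" by (simp add: left_diff_distrib matrix_units)
    finally have tY: "t * toY = toY * t" by simp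
    \<comment> \<open>The block of \<open>q\<close> on X, together with its copy carried over to Y,
      so that \<open>t'\<close> is of the form diag(a, a) as well.\<close>
    define t' where "t' = xpart * q * xpart + toY * q * toX"
    have "t * t' * t = (t * xpart) * q * (xpart * t) + (t * toY) * q * (toX * t)"
      by (simp add: t'_def distrib_left distrib_right mult.assoc)
    also have "(t * xpart) * q * (xpart * t) = xpart * (t * q * t) * xpart"
      by (metis both(1) mult.assoc)
    also have "(t * toY) * q * (toX * t) = toY * (t * q * t) * toX"
      by (metis tY tX mult.assoc)
    also have "xpart * (t * q * t) * xpart + toY * (t * q * t) * toX = t"
      unfolding q tY[symmetric] both(1)[symmetric] by (simp add: mult.assoc matrix_units algebra_simps)
    finally have "t * t' * t = t" .
    moreover have "t' * xpart = xpart * t'"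
      by (simp add: t'_def distrib_left distrib_right mult.assoc matrix_units)
        (simp add: mult.assoc[symmetric] matrix_units)
    moreover have "t' * toX = toX * t'"
      by (simp add: t'_def distrib_left distrib_right mult.assoc matrix_units)
        (simp add: mult.assoc[symmetric] matrix_units)
    ultimately show ?thesis by (auto simp: xskew_def algebra_simps)
  next
    case x then show ?thesis using commuting_quasi_inverse[OF matrix_units(1) x(2) q] by blast
  next
    case s then show ?thesis using commuting_quasi_inverse[OF xskew_idem s(2) q] by blast
  next
    case none then show ?thesis using q by blast
  qed
qed

section \<open>The regular ring and the ideal\<close>

type_synonym endo_family = "nat \<Rightarrow> w1 \<Rightarrow> w1 \<Rightarrow> endo"

text \<open>The index type is left open, so that the same notion serves for the columns within a row
  and for the rows within a column.\<close>

definition noncommuting :: "'r::ring_1 \<Rightarrow> ('p \<Rightarrow> 'x \<Rightarrow> 'r) \<Rightarrow> 'p set" where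
  "noncommuting q s = {p. \<exists>x. s p x * q \<noteq> q * s p x}"

lemma noncommuting_mult: "noncommuting q (s * t) \<subseteq> noncommuting q s \<union> noncommuting q t"
proof -
  have "s p x * t p x * q = q * (s p x * t p x)"
    if "s p x * q = q * s p x" "t p x * q = q * t p x" for p x
    by (metis that mult.assoc)
  then show ?thesis by (auto simp: noncommuting_def)
qed

lemma noncommuting_diff: "noncommuting q (s - t) \<subseteq> noncommuting q s \<union> noncommuting q t"
  by (auto simp: noncommuting_def algebra_simps)

definition almost_commuting :: "endo_family set" where
  "almost_commuting = {s. (\<forall>i. finite (noncommuting xpart (s i))) \<and>
              (\<forall>j. finite (noncommuting xskew (\<lambda>i. s i j)))}"

text \<open>One choice of quasi-inverses that preserves commutation with each of the two projections
  is applied to all values, so the quasi-inverse has no new exceptional points in any row or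
  column.\<close>

lemma regular_almost_commuting: "regular_subring almost_commuting"
proof
  show "1 \<in> almost_commuting" by (simp add: almost_commuting_def noncommuting_def)
  show "s - t \<in> almost_commuting" "s * t \<in> almost_commuting" if "s \<in> almost_commuting" "t \<in> almost_commuting" for s t
  proof -
    have fin: "finite (noncommuting xpart (s i))" "finite (noncommuting xpart (t i))"
      "finite (noncommuting xskew (\<lambda>i. s i j))" "finite (noncommuting xskew (\<lambda>i. t i j))" for i j
      using that by (simp_all add: almost_commuting_def)
    have "finite (noncommuting xpart (s i - t i))" "finite (noncommuting xpart (s i * t i))"
      "finite (noncommuting xskew ((\<lambda>i. s i j) - (\<lambda>i. t i j)))"
      "finite (noncommuting xskew ((\<lambda>i. s i j) * (\<lambda>i. t i j)))" for i j
      by (auto intro: finite_subset[OF noncommuting_diff] finite_subset[OF noncommuting_mult] fin)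
    then show "s - t \<in> almost_commuting" "s * t \<in> almost_commuting"
      by (simp_all add: almost_commuting_def noncommuting_def)
  qed
  show "\<exists>y\<in>almost_commuting. s * y * s = s" if s: "s \<in> almost_commuting" for s
  proof -
    obtain q where q: "\<And>t. t * q t * t = t" "\<And>t. t * xpart = xpart * t \<Longrightarrow> q t * xpart = xpart * q t"
      "\<And>t. t * xskew = xskew * t \<Longrightarrow> q t * xskew = xskew * q t"
      using endo_commuting_quasi_inverse by metis
    define y where "y = (\<lambda>i j x. q (s i j x))"
    have sub: "noncommuting xpart (y i) \<subseteq> noncommuting xpart (s i)"
      "noncommuting xskew (\<lambda>i. y i j) \<subseteq> noncommuting xskew (\<lambda>i. s i j)" for i j
      using q by (auto simp: y_def noncommuting_def)
    then have "y \<in> almost_commuting"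
      using s by (auto simp: almost_commuting_def intro: finite_subset[OF sub(1)] finite_subset[OF sub(2)])
    moreover have "s * y * s = s" by (auto simp: y_def q fun_eq_iff)
    ultimately show ?thesis by blast
  qed
qed

definition row :: "nat \<Rightarrow> endo_family" where
  "row i = (\<lambda>i' j x. if i' = i then xpart else 0)"

definition column :: "w1 \<Rightarrow> endo_family" where
  "column j = (\<lambda>i j' x. if j' = j then xskew else 0)"

definition point :: "nat \<times> w1 \<Rightarrow> endo_family" where
  "point p = (\<lambda>i j x. if (i, j) = p then 1 else 0)"

definition initial :: "w1 \<Rightarrow> endo_family" where
  "initial b = (\<lambda>i j x. if x < b then 1 else 0)"

definition const :: "(nat \<Rightarrow> nat option) \<Rightarrow> endo_family" where
  "const h = (\<lambda>i j x. reindex h)"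

text \<open>\<open>const (unit_map i j)\<close> maps the block \<open>{j, j + 5, j + 10, \<dots>}\<close> of coordinates onto the block
  \<open>{i, i + 5, i + 10, \<dots>}\<close>. Thus block 9 is block 4 without its first coordinate.\<close>

definition unit_map :: "nat \<Rightarrow> nat \<Rightarrow> nat \<Rightarrow> nat option" where
  "unit_map i j n = (if i \<le> n \<and> n mod 5 = i mod 5 then Some (n - i + j) else None)"

text \<open>\<open>corner * t = 0\<close> says that the range of \<open>t\<close> lies in the
  hyperplane W. The chosen coordinate belongs to Y, so W contains X, and it is the first coordinate
  of block 4.\<close>

definition corner :: endo where
  "corner = Endo (\<lambda>v b n. if \<not> b \<and> n = 4 then v False 4 else 0)"

lemma app_corner: "app corner v b n = (if \<not> b \<and> n = 4 then v False 4 else 0)"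
  unfolding corner_def by (subst app_Endo) (auto simp: vscale_def fun_eq_iff)

definition generators :: "endo_family set" where
  "generators = range row \<union> range column \<union> range point \<union> range initial \<union>
     const ` range (\<lambda>(i, j). unit_map i j)"

text \<open>\<open>row i\<close> meets each column only at \<open>i\<close>, and
  \<open>column j\<close> meets each row only at \<open>j\<close>, so each can violate the other
  family's condition at one point at most. The remaining generators commute with both projections
  everywhere.\<close>

lemma generators_almost_commuting: "generators \<subseteq> almost_commuting"
proof -
  have "row i \<in> almost_commuting" for i
  proof -
    have "noncommuting xskew (\<lambda>i'. row i i' j) \<subseteq> {i}" "noncommuting xpart (row i i') = {}" for i' j
      by (auto simp: row_def noncommuting_def)
    then show ?thesis by (auto simp: almost_commuting_def intro: finite_subset)
  qed
  moreover have "column j \<in> almost_commuting" for j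
  proof -
    have "noncommuting xpart (column j i) \<subseteq> {j}" "noncommuting xskew (\<lambda>i. column j i j') = {}" for i j'
      by (auto simp: column_def noncommuting_def)
    then show ?thesis by (auto simp: almost_commuting_def intro: finite_subset)
  qed
  ultimately show ?thesis
    by (auto simp: generators_def almost_commuting_def noncommuting_def point_def initial_def const_def reindex_xpart reindex_xskew)
qed

lemma infinite_w1: "infinite (UNIV :: w1 set)"
  using uncountable_w1 countable_finite by blast

lemma card_generators: "|generators| \<le>o |UNIV :: w1 set|"
proof -
  let ?U = "|UNIV :: w1 set|"
  have un: "|A \<union> B| \<le>o ?U" if "|A| \<le>o ?U" "|B| \<le>o ?U" for A B :: "endo_family set"
    by (rule card_of_Un_ordLeq_infinite_Field)
      (use that infinite_w1 in \<open>simp_all add: Field_card_of card_of_card_order_on\<close>)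
  have im: "|F ` A| \<le>o ?U" if "|A| \<le>o ?U" for F :: "'x \<Rightarrow> endo_family" and A
    using card_of_image that ordLeq_transitive by blast
  have ctb: "|A| \<le>o ?U" if "countable A" for A :: "'x set"
    using that natLeq_less_w1 ordLeq_ordLess_trans ordLess_imp_ordLeq
    by (metis countable_card_le_natLeq)
  have "|UNIV \<times> UNIV :: (nat \<times> w1) set| \<le>o ?U"
    by (rule card_of_Times_ordLeq_infinite_Field)
      (use infinite_w1 ctb[of "UNIV :: nat set"] in
        \<open>simp_all add: Field_card_of card_of_card_order_on card_of_mono1\<close>)
  then have "|range point| \<le>o ?U" by (intro im) (simp only: UNIV_Times_UNIV)
  moreover have "|range row| \<le>o ?U" "|const ` range (\<lambda>(i, j). unit_map i j)| \<le>o ?U"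
    by (rule im[OF ctb], simp)+
  moreover have "|range column| \<le>o ?U" "|range initial| \<le>o ?U"
    by (rule im, simp add: card_of_mono1)+
  ultimately show ?thesis unfolding generators_def by (intro un)
qed

section \<open>The lattice of bounded right ideals\<close>

locale twisted = regular_subring S for S :: "endo_family set" +
  fixes g :: "endo_family set \<Rightarrow> 'b"
  assumes generators: "generators \<subseteq> S"
    and S_almost_commuting: "S \<subseteq> almost_commuting"
    and inj_g: "inj_on g rideals"
begin

text \<open>Imposing the hyperplane condition only from some \<open>b\<close> on keeps every
  \<open>initial b\<close> in the lattice; these are the test elements in the argument against
  coordinatization.\<close>

definition bounded_ideals :: "endo_family set set" where
  "bounded_ideals = {A \<in> rideals. \<exists>b. \<forall>s\<in>A. \<forall>i j x. b \<le> x \<longrightarrow> corner * s i j x = 0}"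

lemma bounded_ideals_E:
  assumes "A \<in> bounded_ideals"
  obtains b where "\<And>s i j x. \<lbrakk>s \<in> A; b \<le> x\<rbrakk> \<Longrightarrow> corner * s i j x = 0"
  using assms unfolding bounded_ideals_def by blast

lemma generators_mem [simp]: "row i \<in> S" "column j \<in> S" "point p \<in> S" "initial b \<in> S"
  "const (unit_map k l) \<in> S"
proof -
  have "const (unit_map k l) \<in> const ` range (\<lambda>(i, j). unit_map i j)"
    by (intro imageI range_eqI[of _ _ "(k, l)"]) simp
  then show "const (unit_map k l) \<in> S" using generators unfolding generators_def by (meson UnI2 subsetD)
qed (use generators in \<open>auto simp: generators_def\<close>)

lemma rid_bounded:
  assumes "s \<in> S" "\<And>i j x. b \<le> x \<Longrightarrow> corner * s i j x = 0"
  shows "rid s \<in> bounded_ideals"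
  unfolding bounded_ideals_def using assms rid_rideals
  by (auto simp: rid_def mult.assoc[symmetric] intro!: exI[of _ b])

sublocale right_ideals S g bounded_ideals
proof
  show "inj_on g rideals" by (rule inj_g)
  show "bounded_ideals \<subseteq> rideals" by (auto simp: bounded_ideals_def)
  show "{0} \<in> bounded_ideals" using zero_rideals by (auto simp: bounded_ideals_def)
  show "B \<in> bounded_ideals" if "A \<in> bounded_ideals" "B \<in> rideals" "B \<subseteq> A" for A B
    using that unfolding bounded_ideals_def by blast
  show "psum A B \<in> bounded_ideals" if "A \<in> bounded_ideals" "B \<in> bounded_ideals" for A B
  proof -
    obtain a where a: "\<And>s i j x. s \<in> A \<Longrightarrow> a \<le> x \<Longrightarrow> corner * s i j x = 0"
      using bounded_ideals_E \<open>A \<in> bounded_ideals\<close> by blast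
    obtain b where b: "\<And>s i j x. s \<in> B \<Longrightarrow> b \<le> x \<Longrightarrow> corner * s i j x = 0"
      using bounded_ideals_E \<open>B \<in> bounded_ideals\<close> by blast
    have "corner * s i j x = 0" if "s \<in> psum A B" "max a b \<le> x" for s i j x
      using that a b by (auto simp: psum_def distrib_left)
    then have "\<exists>b. \<forall>s\<in>psum A B. \<forall>i j x. b \<le> x \<longrightarrow> corner * s i j x = 0" by blast
    then show ?thesis using that psum_rideals by (simp add: bounded_ideals_def)
  qed
qed

lemma row_bounded: "rid (row i) \<in> bounded_ideals"
proof (rule rid_bounded)
  show "corner * row i i' j x = 0" for i' j x
    by (rule endo_eqI) (auto simp: row_def fun_eq_iff app_corner app_xpart)
qed simp

lemma column_bounded: "rid (column j) \<in> bounded_ideals"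
proof (rule rid_bounded)
  show "corner * column j i j' x = 0" for i j' x
    by (rule endo_eqI) (auto simp: column_def fun_eq_iff app_corner app_xskew)
qed simp

lemma initial_bounded: "rid (initial b) \<in> bounded_ideals"
proof (rule rid_bounded)
  show "corner * initial b i j x = 0" if "b \<le> x" for i j x
    using that by (simp add: initial_def leD)
qed simp

lemma initial_mono: "b \<le> c \<Longrightarrow> rid (initial b) \<subseteq> rid (initial c)"
proof -
  assume "b \<le> c"
  then have "initial b = initial c * initial b" by (auto simp: initial_def fun_eq_iff)
  then show ?thesis using rid_mult_subset[of "initial c" "initial b"] by simp
qed

lemma point_central: "point p * s = s * point p"
  by (auto simp: point_def fun_eq_iff)

end

section \<open>Impossibility of a coordinatization\<close>

locale twisted_coordinatized = twisted S g + R: regular_ring R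
  for S :: "endo_family set" and g :: "endo_family set \<Rightarrow> 'b" and R :: "('r, 'm) ring_scheme" (structure) +
  fixes \<phi> :: "endo_family set \<Rightarrow> 'r set"
  assumes phi_principal: "A \<in> bounded_ideals \<Longrightarrow> \<exists>x\<in>carrier R. \<phi> A = x <# carrier R"
    and phi_surj: "x \<in> carrier R \<Longrightarrow> \<exists>A\<in>bounded_ideals. \<phi> A = x <# carrier R"
    and phi_le: "\<lbrakk>A \<in> bounded_ideals; B \<in> bounded_ideals\<rbrakk> \<Longrightarrow> \<phi> A \<subseteq> \<phi> B \<longleftrightarrow> A \<subseteq> B"
begin

definition is_kernel :: "'r \<Rightarrow> endo_family set \<Rightarrow> endo_family set \<Rightarrow> bool" where
  "is_kernel e A k \<longleftrightarrow> k \<in> bounded_ideals \<and> \<phi> k = {r \<in> \<phi> A. e \<otimes> r = \<zero>}"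

lemma phi_idem:
  assumes "A \<in> bounded_ideals"
  obtains e where "e \<in> carrier R" "e \<otimes> e = e" "\<phi> A = e <# carrier R"
  using phi_principal[OF assms] R.principal_idem by metis

lemma phi_add:
  assumes "A \<in> bounded_ideals" "r \<in> \<phi> A" "s \<in> \<phi> A"
  shows "r \<oplus> s \<in> \<phi> A"
proof -
  obtain e where e: "e \<in> carrier R" "e \<otimes> e = e" "\<phi> A = e <# carrier R" using phi_idem assms(1) by blast
  then show ?thesis using assms R.r_distr[of r s e] by (simp add: R.mem_idem_iff)
qed

lemma phi_carrier:
  assumes "A \<in> bounded_ideals"
  shows "\<phi> A \<subseteq> carrier R"
proof -
  obtain e where "e \<in> carrier R" "e \<otimes> e = e" "\<phi> A = e <# carrier R" using phi_idem assms by blast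
  then show ?thesis by (auto simp: R.mem_idem_iff)
qed

text \<open>Writing \<open>r\<close> as \<open>e r + (r - e r)\<close> splits
  \<open>\<phi> A\<close> into \<open>\<phi> Q\<close> and the annihilator of \<open>e\<close>. The
  isomorphism carries this over to \<open>S\<close>, where the kernel becomes a complement of
  \<open>Q\<close> in \<open>A\<close>.\<close>

lemma ex_kernel:
  assumes "A \<in> bounded_ideals" "Q \<in> bounded_ideals" "Q \<subseteq> A" "e \<in> carrier R" "e \<otimes> e = e" "\<phi> Q = e <# carrier R"
  obtains k where "is_kernel e A k" "psum Q k = A" "Q \<inter> k = {0}"
proof -
  obtain h where h: "h \<in> carrier R" "h \<otimes> h = h" "\<phi> A = h <# carrier R"
    using phi_idem assms(1) by blast
  have "e \<in> \<phi> Q" using assms R.mem_idem_iff by simp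
  then have "e \<in> \<phi> A" using phi_le assms by blast
  then have he: "h \<otimes> e = e" using R.mem_idem_iff h by simp
  obtain t where t: "t \<in> carrier R" "t <# carrier R = {r \<in> h <# carrier R. e \<otimes> r = \<zero>}"
    "\<forall>r\<in>h <# carrier R. r \<ominus> e \<otimes> r \<in> t <# carrier R"
    by (rule R.principal_annihilator[OF assms(4,5) h(1,2) he])
  obtain k where k: "k \<in> bounded_ideals" "\<phi> k = t <# carrier R" using phi_surj t by blast
  then have ker: "is_kernel e A k" using t h by (simp add: is_kernel_def)
  have kA: "k \<subseteq> A" using phi_le[OF k(1) assms(1)] k t h by auto
  have P: "psum Q k \<in> bounded_ideals" using I_psum assms k by blast
  have "\<phi> A \<subseteq> \<phi> (psum Q k)"
  proof
    fix r assume r: "r \<in> \<phi> A"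
    then have c: "r \<in> carrier R" using phi_carrier assms by blast
    have "e \<otimes> r \<in> \<phi> Q" unfolding assms(6) using c assms by (intro R.mult_mem_principal)
    moreover have "r \<ominus> e \<otimes> r \<in> \<phi> k" using r h t k by simp
    moreover have "\<phi> Q \<subseteq> \<phi> (psum Q k)" "\<phi> k \<subseteq> \<phi> (psum Q k)"
      using phi_le[OF assms(2) P] phi_le[OF k(1) P] psum_upper[of Q k] rideal_I assms(2) k(1) by blast+
    ultimately have "(r \<ominus> e \<otimes> r) \<oplus> e \<otimes> r \<in> \<phi> (psum Q k)" using phi_add[OF P] by blast
    moreover have "(r \<ominus> e \<otimes> r) \<oplus> e \<otimes> r = r"
      using R.eq_minus_iff[of "r \<ominus> e \<otimes> r" "e \<otimes> r" r] c assms R.m_closed by simp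
    ultimately show "r \<in> \<phi> (psum Q k)" by simp
  qed
  then have "psum Q k = A"
    using phi_le[OF assms(1) P] psum_subset_iff[of Q k A] assms k kA rideal_I by auto
  moreover have "Q \<inter> k = {0}"
  proof -
    have Qk: "Q \<inter> k \<in> bounded_ideals" using Int_I assms k by blast
    have "r = \<zero>" if "r \<in> \<phi> (Q \<inter> k)" for r
    proof -
      have "r \<in> \<phi> Q" "r \<in> \<phi> k"
        using that phi_le[OF Qk assms(2)] phi_le[OF Qk k(1)] by auto
      then show ?thesis using assms R.mem_idem_iff ker by (auto simp: is_kernel_def)
    qed
    moreover have "\<zero> \<in> \<phi> {0}"
      using phi_principal[OF I_zero] R.null_mult(2) R.mult_mem_principal R.zero_closed by metis
    ultimately have "\<phi> (Q \<inter> k) \<subseteq> \<phi> {0}" by blast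
    then show ?thesis using phi_le[OF Qk I_zero] rideal_zero[OF rideal_I[OF Qk]] by auto
  qed
  ultimately show ?thesis using that ker by blast
qed

text \<open>The points at which the kernel that the lattice assigns to \<open>e\<close>, on
  everything below \<open>b\<close>, is not contained in the kernel of \<open>q\<close>.\<close>

definition bad :: "'r \<Rightarrow> endo_family \<Rightarrow> w1 \<Rightarrow> (nat \<times> w1) set" where
  "bad e q b = {(i, j). \<exists>k s x. is_kernel e (psum (rid q) (rid (initial b))) k \<and> s \<in> k \<and> q i j x * s i j x \<noteq> 0}"

text \<open>At a point where the generator \<open>t\<close> of the kernel commutes with \<open>q\<close>, the product \<open>q t\<close>
  lies in both summands and therefore vanishes. The finite exceptional sets increase along
  \<open>w1\<close>, so even their union is finite.\<close>

lemma finite_bad: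
  assumes q: "q \<in> S" "rid q \<in> bounded_ideals" and e: "e \<in> carrier R" "e \<otimes> e = e" "\<phi> (rid q) = e <# carrier R"
    and line: "\<And>t. t \<in> S \<Longrightarrow> finite {(i, j) \<in> Q. \<exists>x. t i j x * q i j x \<noteq> q i j x * t i j x}"
  shows "finite (\<Union>b. bad e q b \<inter> Q)"
proof (rule finite_Union_w1_chain)
  note QI = rideal_I[OF q(2)]
  have U: "psum (rid q) (rid (initial b)) \<in> bounded_ideals" for b using I_psum q initial_bounded by blast
  show "finite (bad e q b \<inter> Q)" for b
  proof -
    obtain k where k: "is_kernel e (psum (rid q) (rid (initial b))) k" "rid q \<inter> k = {0}"
      using ex_kernel[OF U[of b] q(2) psum_upper(1)[OF QI rideal_I[OF initial_bounded]] e] by metis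
    have uniq: "k' = k" if "is_kernel e (psum (rid q) (rid (initial b))) k'" for k'
      using that k(1) phi_le[of k k'] phi_le[of k' k] by (auto simp: is_kernel_def)
    have kPI: "k \<in> rideals" using k(1) rideal_I by (simp add: is_kernel_def)
    then obtain t where t: "t \<in> S" "k = rid t" by (auto simp: rideals_def)
    have "q i j x * s i j x = 0" if "s \<in> k" and c: "\<forall>x. t i j x * q i j x = q i j x * t i j x" for i j x s
    proof -
      \<comment> \<open>This central idempotent localizes at the point: there \<open>t * q\<close>
        and \<open>q * t\<close> agree, the first lying in \<open>k\<close> and the second in
        \<open>rid q\<close>.\<close>
      let ?d = "point (i, j)"
      have eq: "?d * (t * q) = ?d * (q * t)" using c by (auto simp: point_def fun_eq_iff)
      have "?d * (t * q) = t * (?d * q)" by (metis mult.assoc point_central)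
      then have "?d * (t * q) \<in> k" unfolding t(2) rid_def using q t by (simp add: mems)
      moreover have "?d * (q * t) = q * (?d * t)" by (metis mult.assoc point_central)
      then have "?d * (q * t) \<in> rid q" unfolding rid_def using q t by (simp add: mems)
      ultimately have "?d * (q * t) = 0" using eq k(2) by auto
      then have "(?d * (q * t)) i j x = 0" by simp
      then have "q i j x * t i j x = 0" by (simp add: point_def)
      moreover obtain r where "s = t * r" using \<open>s \<in> k\<close> t(2) by (auto simp: rid_def)
      ultimately show ?thesis by (simp add: mult.assoc[symmetric])
    qed
    then have "bad e q b \<inter> Q \<subseteq> {(i, j) \<in> Q. \<exists>x. t i j x * q i j x \<noteq> q i j x * t i j x}"
      using uniq unfolding bad_def by blast
    then show ?thesis using line[OF t(1)] finite_subset by blast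
  qed
  show "bad e q b \<inter> Q \<subseteq> bad e q c \<inter> Q" if "b \<le> c" for b c
  proof -
    let ?U = "\<lambda>b. psum (rid q) (rid (initial b))"
    have ini: "rid (initial b) \<in> rideals" for b using initial_bounded rideal_I by blast
    have "?U b \<subseteq> ?U c"
      using psum_subset_iff[OF QI ini[of b] rideal_I[OF U[of c]]] psum_upper[OF QI ini[of c]] initial_mono[OF that]
      by blast
    then have le: "\<phi> (?U b) \<subseteq> \<phi> (?U c)" using phi_le U by blast
    obtain k' where k': "is_kernel e (?U c) k'"
      using ex_kernel[OF U[of c] q(2) psum_upper(1)[OF QI ini] e] by metis
    \<comment> \<open>Enlarging the ambient ideal only enlarges the annihilator of \<open>e\<close>
      in it.\<close>
    have "k \<subseteq> k'" if "is_kernel e (?U b) k" for k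
      using that k' le phi_le[of k k'] by (auto simp: is_kernel_def)
    then show ?thesis using k' unfolding bad_def by blast
  qed
qed

text \<open>By \<open>e' e = e'\<close> whatever \<open>e\<close> annihilates on its right is
  annihilated by \<open>e'\<close>. The factor \<open>d\<close> moves \<open>s\<close> below
  \<open>initial b\<close>, into the ideal where the kernel of \<open>e'\<close> is taken.\<close>

lemma small_multiple:
  assumes "is_kernel e A k" "is_kernel e' (psum (rid q) (rid (initial b))) k'" "rid q \<in> bounded_ideals"
    and "e' \<otimes> e = e'" "e \<in> carrier R" "e' \<in> carrier R" "s \<in> k" "d \<in> S" "initial b * d = d" "s * d = d * s"
  shows "s * d \<in> k'"
proof -
  have k: "k \<in> bounded_ideals" "k' \<in> bounded_ideals" using assms by (auto simp: is_kernel_def)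
  have sS: "s \<in> S" using assms(7) k rideal_I rideal_subset by blast
  have sd: "s * d \<in> k" using rideal_mult[OF rideal_I] k assms by blast
  have sdS: "rid (s * d) \<in> bounded_ideals"
    using I_down[OF k(1) rid_rideals] sd rid_subset_iff[OF rideal_I[OF k(1)]] mems(6)[OF sS assms(8)] by blast
  have ub: "psum (rid q) (rid (initial b)) \<in> bounded_ideals" using I_psum assms initial_bounded by blast
  have "s * d = initial b * (d * s)" using assms(9,10) by (metis mult.assoc)
  then have "s * d \<in> rid (initial b)" unfolding rid_def using sS assms(8) mems(6) by blast
  then have "rid (s * d) \<subseteq> psum (rid q) (rid (initial b))"
    using psum_upper(2)[OF rideal_I[OF assms(3)] rideal_I[OF initial_bounded]] rid_subset_iff[OF rideal_I[OF initial_bounded]] by blast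
  then have 1: "\<phi> (rid (s * d)) \<subseteq> \<phi> (psum (rid q) (rid (initial b)))" using phi_le sdS ub by blast
  have "rid (s * d) \<subseteq> k" using sd rid_subset_iff[OF rideal_I[OF k(1)]] by blast
  then have 2: "\<phi> (rid (s * d)) \<subseteq> \<phi> k" using phi_le sdS k by blast
  have "e' \<otimes> r = \<zero>" if "r \<in> \<phi> (rid (s * d))" for r
  proof -
    have r: "r \<in> carrier R" "e \<otimes> r = \<zero>"
      using 2 that assms(1) phi_carrier[OF sdS] by (auto simp: is_kernel_def)
    then have "e' \<otimes> r = e' \<otimes> (e \<otimes> r)" using assms R.m_assoc[of e' e r] by simp
    then show ?thesis using r assms R.null_mult by simp
  qed
  then have "\<phi> (rid (s * d)) \<subseteq> \<phi> k'" using 1 assms(2) by (auto simp: is_kernel_def)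
  then show ?thesis using phi_le[OF sdS k(2)] rid_self by blast
qed

lemma no_coordinatization: False
proof -
  have "\<exists>e. e \<in> carrier R \<and> e \<otimes> e = e \<and> \<phi> (rid (row i)) = e <# carrier R" for i
    using phi_idem[OF row_bounded] by metis
  then obtain er where er: "er i \<in> carrier R" "er i \<otimes> er i = er i" "\<phi> (rid (row i)) = er i <# carrier R" for i
    by metis
  have "\<exists>e. e \<in> carrier R \<and> e \<otimes> e = e \<and> \<phi> (rid (column j)) = e <# carrier R" for j
    using phi_idem[OF column_bounded] by metis
  then obtain ec where ec: "ec j \<in> carrier R" "ec j \<otimes> ec j = ec j" "\<phi> (rid (column j)) = ec j <# carrier R" for j
    by metis
  define br where "br i = (\<Union>b. bad (er i) (row i) b \<inter> {i} \<times> UNIV)" for i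
  define bc where "bc j = (\<Union>b. bad (ec j) (column j) b \<inter> UNIV \<times> {j})" for j
  have br: "finite (br i)" for i unfolding br_def
  proof (rule finite_bad[OF _ row_bounded er])
    fix t assume "t \<in> S"
    then have "finite (Pair i ` noncommuting xpart (t i))"
      using S_almost_commuting by (auto simp: almost_commuting_def)
    then show "finite {(i', j) \<in> {i} \<times> UNIV. \<exists>x. t i' j x * row i i' j x \<noteq> row i i' j x * t i' j x}"
      by (rule finite_subset[rotated]) (auto simp: row_def image_iff noncommuting_def)
  qed simp
  have bc: "finite (bc j)" for j unfolding bc_def
  proof (rule finite_bad[OF _ column_bounded ec])
    fix t assume "t \<in> S"
    then have "finite ((\<lambda>i. (i, j)) ` noncommuting xskew (\<lambda>i. t i j))"
      using S_almost_commuting by (auto simp: almost_commuting_def)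
    then show "finite {(i, j') \<in> UNIV \<times> {j}. \<exists>x. t i j' x * column j i j' x \<noteq> column j i j' x * t i j' x}"
      by (rule finite_subset[rotated]) (auto simp: column_def image_iff noncommuting_def)
  qed simp
  \<comment> \<open>The column is chosen first, outside the countably many columns that are
    exceptional for some row; then the row is chosen outside the finitely many that are exceptional
    for this column.\<close>
  have "countable (\<Union>i. snd ` br i)" using br by (auto intro: countable_finite)
  then obtain j where j: "j \<notin> (\<Union>i. snd ` br i)" using uncountable_w1 by (metis UNIV_eq_I)
  obtain i where i: "i \<notin> fst ` bc j" using bc[of j] by (metis ex_new_if_finite finite_imageI infinite_UNIV_nat)
  obtain e where e: "e \<in> carrier R" "e \<otimes> e = e" "er i \<otimes> e = er i" "ec j \<otimes> e = ec j"
    using R.ex_common_right_unit[OF er(1,2) ec(1)] by metis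
  obtain Z where Z: "Z \<in> bounded_ideals" "\<phi> Z = e <# carrier R" using phi_surj e by blast
  obtain b where b: "\<And>s i j x. s \<in> Z \<Longrightarrow> b \<le> x \<Longrightarrow> corner * s i j x = 0"
    using bounded_ideals_E[OF Z(1)] by blast
  \<comment> \<open>Coordinate \<open>b\<close> is thus both beyond the bound of \<open>Z\<close>
    and inside the segment of \<open>initial c\<close>.\<close>
  obtain c where c: "b < c" using countable_bounded_w1[of "{b}"] by auto
  define u where "u = psum Z (rid (initial c))"
  have u: "u \<in> bounded_ideals" "Z \<subseteq> u" "rid (initial c) \<subseteq> u"
    unfolding u_def using I_psum Z initial_bounded psum_upper rideal_I by auto
  obtain k where k: "is_kernel e u k" "psum Z k = u" using ex_kernel[OF u(1) Z(1) u(2) e(1,2) Z(2)] by metis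
  define d where "d = point (i, j) * initial c"
  have "d \<in> S" by (simp add: d_def mems)
  moreover have "initial c * d = d" "s * d = d * s" for s
    by (auto simp: d_def point_def initial_def fun_eq_iff)
  ultimately have d: "d \<in> S" "initial c * d = d" "s * d = d * s" for s by blast+
  have "d \<in> rid (initial c)" using d(1,2) unfolding rid_def by (metis imageI)
  \<comment> \<open>The identity localized at the point splits into a part in \<open>Z\<close> and a
    part in the kernel of \<open>e\<close>. The kernel part will vanish at \<open>(i, j, b)\<close>,
    leaving the identity to the \<open>Z\<close> part, whose range is confined to the hyperplane
    there.\<close>
  then obtain z s where zs: "z \<in> Z" "s \<in> k" "d = z + s" using u(3) k(2) by (auto simp: psum_def)
  have d1: "d i j b = 1" using c by (simp add: d_def point_def initial_def)
  have ini: "rid (initial c) \<in> rideals" using initial_bounded rideal_I by blast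
  obtain k1 where k1: "is_kernel (er i) (psum (rid (row i)) (rid (initial c))) k1"
    using ex_kernel[OF I_psum[OF row_bounded initial_bounded] row_bounded psum_upper(1)[OF rideal_I[OF row_bounded] ini] er] by metis
  have "s * d \<in> k1" by (rule small_multiple[OF k(1) k1 row_bounded e(3) e(1) er(1) zs(2) d])
  moreover have "(i, j) \<notin> bad (er i) (row i) c" using j by (force simp: br_def)
  ultimately have "row i i j b * (s * d) i j b = 0" using k1 unfolding bad_def by blast
  then have x0: "xpart * s i j b = 0" by (simp add: row_def d1)
  obtain k2 where k2: "is_kernel (ec j) (psum (rid (column j)) (rid (initial c))) k2"
    using ex_kernel[OF I_psum[OF column_bounded initial_bounded] column_bounded psum_upper(1)[OF rideal_I[OF column_bounded] ini] ec] by metis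
  have "s * d \<in> k2" by (rule small_multiple[OF k(1) k2 column_bounded e(4) e(1) ec(1) zs(2) d])
  moreover have "(i, j) \<notin> bad (ec j) (column j) c" using i by (force simp: bc_def)
  ultimately have "column j i j b * (s * d) i j b = 0" using k2 unfolding bad_def by blast
  then have "xskew * s i j b = 0" by (simp add: column_def d1)
  with x0 have "s i j b = 0" by (rule xpart_xskew_joint_kernel)
  then have "z i j b = 1" using d1 zs(3) by simp
  then have "corner = 0" using b[OF zs(1), of b i j] by simp
  then have "app corner (\<lambda>_ _. 1) False 4 = 0" by simp
  then show False by (simp add: app_corner)
qed

end

section \<open>Matrix units between blocks of coordinates\<close>

lemma const_mult: "const h * const k = const (\<lambda>n. Option.bind (h n) k)"
  by (auto simp: const_def fun_eq_iff reindex_mult)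

text \<open>The truncated subtraction is harmless because \<open>i \<le> n\<close> on the block. The
  starting points may share a residue, as 4 and 9 do.\<close>

lemma unit_mult: "const (unit_map i j) * const (unit_map j k) = const (unit_map i k)"
proof -
  have "(n - i + j) mod 5 = j mod 5" if "i \<le> n" "n mod 5 = i mod 5" for n
    using that by (metis add.commute mod_add_right_eq mod_eq_dvd_iff_nat dvd_imp_mod_0 add_0_right)
  then show ?thesis
    unfolding const_mult by (intro arg_cong[of _ _ const] ext) (auto simp: unit_map_def)
qed

lemma unit_mult_zero:
  assumes "j mod 5 \<noteq> k mod 5"
  shows "const (unit_map i j) * const (unit_map k l) = 0"
proof -
  have "(n - i + j) mod 5 = j mod 5" if "i \<le> n" "n mod 5 = i mod 5" for n
    using that by (metis add.commute mod_add_right_eq mod_eq_dvd_iff_nat dvd_imp_mod_0 add_0_right)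
  then have "(\<lambda>n. Option.bind (unit_map i j n) (unit_map k l)) = (\<lambda>n. None)"
    using assms by (auto simp: unit_map_def fun_eq_iff)
  then have "const (unit_map i j) * const (unit_map k l) = const (\<lambda>n. None)"
    unfolding const_mult by simp
  also have "\<dots> = 0"
    by (auto simp: const_def fun_eq_iff app_reindex intro!: endo_eqI)
  finally show ?thesis .
qed

lemma app_sum: "app (sum f A) v b n = (\<Sum>i\<in>A. app (f i) v b n)"
  by (induction A rule: infinite_finite_induct) auto

lemma sum_const: "(\<Sum>i\<in>A. const (h i)) i' j' x' = (\<Sum>i\<in>A. reindex (h i))"
  by (induction A rule: infinite_finite_induct) (auto simp: const_def)

lemma sum_units: "(\<Sum>i<5. const (unit_map i i)) = 1"
proof -
  have "(\<Sum>i<5. reindex (unit_map i i)) = 1"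
  proof (rule endo_eqI)
    fix v
    \<comment> \<open>For \<open>i < 5\<close> the condition \<open>n mod 5 = i\<close> already
      forces \<open>i \<le> n\<close>, so the five blocks partition the coordinates.\<close>
    have "app (reindex (unit_map i i)) v b n = (if n mod 5 = i then v b n else 0)" if "i < 5" for b n i
      using that mod_less_eq_dividend[of n 5] by (auto simp: app_reindex unit_map_def)
    then show "app (\<Sum>i<5. reindex (unit_map i i)) v = app 1 v"
      by (simp add: fun_eq_iff app_sum)
  qed
  then show ?thesis by (simp add: fun_eq_iff sum_const)
qed

lemma corner_unit:
  assumes "i mod 5 \<noteq> 4 \<or> 4 < i"
  shows "corner * const (unit_map i j) i' j' x = 0"
  using assms by (intro endo_eqI) (auto simp: const_def fun_eq_iff app_corner app_reindex unit_map_def)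

lemma corner_unit4: "corner * const (unit_map 4 4) i' j' x = corner"
  by (intro endo_eqI) (auto simp: const_def fun_eq_iff app_corner app_reindex unit_map_def)

section \<open>Frames, entireness and cardinality\<close>

context twisted
begin

abbreviation un :: "nat \<Rightarrow> nat \<Rightarrow> endo_family" where
  "un i j \<equiv> const (unit_map i j)"

lemma right_ideals_all: "right_ideals S g rideals"
  by unfold_locales (use inj_g zero_rideals psum_rideals in auto)

text \<open>\<open>un j i\<close> carries block \<open>i\<close> onto block \<open>j\<close> with
  inverse \<open>un i j\<close>, so its graph is an axis of perspectivity. The ideal
  \<open>I\<close> is a parameter because both lattices need this.\<close>

lemma axis:
  fixes I i j
  assumes "right_ideals S g I" "rid (un i i) \<in> I" "rid (un j j) \<in> I" "i mod 5 \<noteq> j mod 5"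
  shows "rid (un i i - un j i) \<in> I"
    "perspective_by (ord_of g I) (g (rid (un i i - un j i))) (g (rid (un i i))) (g (rid (un j j)))"
proof -
  interpret J: right_ideals S g I by fact
  have inj: "un i i * r = 0" if "un j i * un i i * r = 0" for r
  proof -
    have "un i j * (un j i * un i i * r) = 0" using that by simp
    then show ?thesis by (simp add: mult.assoc[symmetric] unit_mult)
  qed
  have "un j j = un j i * un i i * un i j" by (simp add: unit_mult)
  then have ex: "\<exists>y\<in>S. un j j = un j i * un i i * y" by (intro bexI[of _ "un i j"]) simp_all
  note ax = J.graph_axis[of "un i i" "un j j" "un j i", OF _ _ _ unit_mult unit_mult_zero unit_mult assms(2,3) inj]
  show "rid (un i i - un j i) \<in> I"
    "perspective_by (ord_of g I) (g (rid (un i i - un j i))) (g (rid (un i i))) (g (rid (un j j)))"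
    using ax(1) ax(3)[OF _ _ _ _ _ ex] assms(4) by (simp_all add: unit_mult)
qed

lemma spanning: "\<exists>a c. spanning_frame (ord_of g rideals) 5 a c"
proof -
  interpret J: right_ideals S g rideals by (rule right_ideals_all)
  have P: "rid (un i j) \<in> rideals" for i j using rid_rideals by simp
  have o: "J.orthogonal_family 5 (\<lambda>i. un i i)"
    unfolding J.orthogonal_family_def using P by (auto simp: unit_mult unit_mult_zero)
  have "rid 1 = S" by (simp add: rid_def)
  then have top: "\<top>\<^bsub>ord_of g rideals\<^esub> = g (rid (\<Sum>i<5. un i i))"
    using J.complemented(2) sum_units by simp
  have "spanning_frame (ord_of g rideals) 5 (\<lambda>i. g (rid (un i i))) (\<lambda>i. g (rid (un 0 0 - un i 0)))"
    unfolding spanning_frame_def frame_def is_direct_sum_def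
    using J.orthogonal_independent[OF o] J.sup_orthogonal_family[OF o] axis[OF right_ideals_all P P, of 0] P top
    by auto
  then show ?thesis by blast
qed

text \<open>Block 4 reaches coordinate 4 for every \<open>x\<close> and so is not bounded; block 9
  avoids that coordinate and is still isomorphic to the other blocks.\<close>

definition start :: "nat \<Rightarrow> nat" where
  "start i = (if i = 4 then 9 else i)"

lemma start_mod: "\<lbrakk>i < 5; j < 5\<rbrakk> \<Longrightarrow> start i mod 5 = start j mod 5 \<longleftrightarrow> i = j"
  by (auto simp: start_def)

lemma start_bounded: "i < 5 \<Longrightarrow> rid (un (start i) (start i)) \<in> bounded_ideals"
  by (rule rid_bounded[OF _ corner_unit]) (auto simp: start_def)

lemma start_orthogonal: "orthogonal_family 5 (\<lambda>i. un (start i) (start i))"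
  unfolding orthogonal_family_def using start_bounded by (auto simp: unit_mult unit_mult_zero start_mod)

lemma homogeneous_start: "homogeneous L 5 (\<lambda>i. g (rid (un (start i) (start i))))"
  unfolding homogeneous_def
proof (intro conjI allI impI)
  show "Defs.independent L 5 (\<lambda>i. g (rid (un (start i) (start i))))"
    by (rule orthogonal_independent[OF start_orthogonal])
  fix i j :: nat assume ij: "i < 5" "j < 5"
  let ?a = "\<lambda>i. rid (un (start i) (start i))"
  show "perspective L (g (?a i)) (g (?a j))"
  proof (cases "i = j")
    case True
    have "?a i \<inter> {0} = {0}" using rideal_zero[OF rideal_I[OF start_bounded[OF ij(1)]]] by auto
    then have "perspective_by L (g {0}) (g (?a i)) (g (?a j))"
      using True start_bounded[OF ij(1)] I_zero by (simp add: perspective_by_def)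
    then show ?thesis using I_zero unfolding perspective_def by auto
  next
    case False
    then show ?thesis
      using axis[OF right_ideals_axioms start_bounded[OF ij(1)] start_bounded[OF ij(2)]] start_mod[OF ij]
      unfolding perspective_def by auto
  qed
qed

lemma sum_start: "(\<Sum>i<4. un (start i) (start i)) = 1 - un 4 4"
proof -
  have "(\<Sum>i<4. un (start i) (start i)) = (\<Sum>i<4. un i i)"
    by (rule sum.cong) (auto simp: start_def)
  moreover have "(\<Sum>i<5. un i i) = (\<Sum>i<4. un i i) + un 4 4"
    using sum.lessThan_Suc[of "\<lambda>i. un i i" 4] by simp
  ultimately show ?thesis using sum_units by (simp add: algebra_simps)
qed

text \<open>The ideal consists of the bounded right ideals inside the whole of block 4, not only
  block 9, since coordinate 4 may occur below a bound. Its members embed into block 0 through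
  \<open>un 0 4\<close>, and cofinality comes from cutting a right ideal into its parts outside and
  inside block 4.\<close>

lemma entire_4_5: "entire 4 5 L"
proof -
  let ?a = "\<lambda>i. g (rid (un (start i) (start i)))"
  let ?s = "g (rid (1 - un 4 4))"
  let ?J = "g ` {A \<in> bounded_ideals. A \<subseteq> rid (un 4 4)}"
  have e: "un 4 4 \<in> S" "un 4 4 * un 4 4 = un 4 4" by (simp_all add: unit_mult)
  have f: "1 - un 4 4 \<in> S" "(1 - un 4 4) * (1 - un 4 4) = 1 - un 4 4"
    using e by (auto simp: algebra_simps intro: mems)
  have sI: "rid (1 - un 4 4) \<in> bounded_ideals"
    using orthogonal_family_sum(5)[OF start_orthogonal, of 4] by (simp add: sum_start)
  have s: "is_direct_sum L 4 ?a ?s"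
    using orthogonal_independent[OF start_orthogonal] sup_orthogonal_family[OF start_orthogonal, of 4] sum_start
    by (auto simp: is_direct_sum_def Defs.independent_def)
  have ideal: "lattice_ideal L ?J"
    unfolding lattice_ideal_def
  proof (intro conjI ballI impI)
    show "?J \<noteq> {}" using I_zero rideal_zero[OF rid_rideals[OF e(1)]] by blast
    fix x assume x: "x \<in> ?J"
    show "y \<in> ?J" if "y \<in> carrier L" "y \<sqsubseteq>\<^bsub>L\<^esub> x" for y using that x by auto
    show "x \<squnion>\<^bsub>L\<^esub> y \<in> ?J" if "y \<in> ?J" for y
      using that x psum_subset_iff[OF rideal_I rideal_I rid_rideals[OF e(1)]] by (auto simp: I_psum)
  qed auto
  have small: "subperspective L x (?a 0) \<and> x = \<Squnion>\<^bsub>L\<^esub> {x} \<and> x \<sqinter>\<^bsub>L\<^esub> ?s = \<bottom>\<^bsub>L\<^esub> \<and> x \<in> carrier L" if "x \<in> ?J" for x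
  proof -
    obtain A where A: "A \<in> bounded_ideals" "A \<subseteq> rid (un 4 4)" "x = g A" using \<open>x \<in> ?J\<close> by blast
    obtain t where t: "t \<in> S" "A = rid t" using rideal_I[OF A(1)] by (auto simp: rideals_def)
    have et: "un 4 4 * t = t" using A(2) t rid_self[of t] mem_rid_idem[OF e] by blast
    have "un 0 0 * t = (un 0 0 * un 4 4) * t" by (simp add: mult.assoc et)
    then have ft: "un 0 0 * t = 0" by (simp add: unit_mult_zero)
    have inj: "t * r = 0" if "un 0 4 * t * r = 0" for r
    proof -
      have "un 4 0 * (un 0 4 * t * r) = 0" using that by simp
      then show ?thesis by (simp add: mult.assoc[symmetric] unit_mult et)
    qed
    have 0: "rid (un 0 0) \<in> bounded_ideals" using start_bounded[of 0] by (simp add: start_def)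
    have "subperspective L x (?a 0)"
      using graph_axis(1,2)[of t "un 0 0" "un 0 4", OF t(1) _ _ unit_mult ft unit_mult _ 0 inj] A t
      by (auto simp: subperspective_def start_def)
    moreover have "\<Squnion>\<^bsub>L\<^esub> {x} = x"
      using A by (intro sup_eqI[OF po.partial_order_axioms]) (auto simp: least_def Upper_def)
    moreover have "A \<inter> rid (1 - un 4 4) = {0}"
    proof -
      have "y = 0" if "y \<in> A" "y \<in> rid (1 - un 4 4)" for y
        using that A(2) mem_rid_idem[OF e] mem_rid_idem[OF f] by (auto simp: left_diff_distrib)
      then show ?thesis using rideal_zero[OF rideal_I] A(1) sI by blast
    qed
    ultimately show ?thesis using A sI by simp
  qed
  have cofinal: "\<exists>x\<in>?J. y \<sqsubseteq>\<^bsub>L\<^esub> ?s \<squnion>\<^bsub>L\<^esub> x" if "y \<in> carrier L" for y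
  proof -
    from that obtain A where A: "A \<in> bounded_ideals" "y = g A" by auto
    obtain t where t: "t \<in> S" "A = rid t" using rideal_I[OF A(1)] by (auto simp: rideals_def)
    obtain b where b: "\<And>s i j x. s \<in> A \<Longrightarrow> b \<le> x \<Longrightarrow> corner * s i j x = 0"
      using bounded_ideals_E[OF A(1)] by blast
    \<comment> \<open>Cutting down to block 4 preserves the bound because \<open>corner\<close>
      reads only a coordinate of that block.\<close>
    have "corner * (un 4 4 * t) i j x = 0" if "b \<le> x" for i j x
      using b[OF _ that, of t i j] rid_self[of t] t corner_unit4[of i j x]
      by (simp add: mult.assoc[symmetric])
    then have B: "rid (un 4 4 * t) \<in> bounded_ideals" using rid_bounded[OF mult_mem[OF e(1) t(1)]] by blast
    moreover have "rid (un 4 4 * t) \<subseteq> rid (un 4 4)" using rid_mult_subset e t by blast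
    moreover have "(1 - un 4 4) * t + un 4 4 * t \<in> psum (rid (1 - un 4 4)) (rid (un 4 4 * t))"
      using t rid_self by (intro psumI) (auto simp: rid_def)
    then have "A \<subseteq> psum (rid (1 - un 4 4)) (rid (un 4 4 * t))"
      using rid_subset_iff[OF psum_rideals[OF rideal_I[OF sI] rideal_I[OF B]], of t] t by (simp add: left_diff_distrib)
    ultimately show ?thesis using A sI I_psum[OF sI B] by (intro bexI[of _ "g (rid (un 4 4 * t))"]) auto
  qed
  have "\<forall>x\<in>?J. (\<exists>b. (\<forall>i<(5::nat) - 4. b i \<in> carrier L \<and> subperspective L (b i) (?a 0)) \<and>
      x = \<Squnion>\<^bsub>L\<^esub> (b ` {..<(5::nat) - 4})) \<and> x \<sqinter>\<^bsub>L\<^esub> ?s = \<bottom>\<^bsub>L\<^esub>"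
  \<comment> \<open>Here \<open>m - n\<close> is 1, so each \<open>x\<close> is the join of the
    single element \<open>x\<close>.\<close>
  proof (intro ballI conjI exI[of _ "\<lambda>_. _"])
    fix x assume "x \<in> ?J"
    note x = small[OF this]
    have "(\<lambda>_. x) ` {..<(5::nat) - 4} = {x}" by auto
    then show "x = \<Squnion>\<^bsub>L\<^esub> ((\<lambda>_. x) ` {..<(5::nat) - 4})" using x by simp
    show "\<forall>i<(5::nat) - 4. x \<in> carrier L \<and> subperspective L x (?a 0)" using x by blast
    show "x \<sqinter>\<^bsub>L\<^esub> ?s = \<bottom>\<^bsub>L\<^esub>" using x by blast
  qed
  moreover have "\<forall>y\<in>carrier L. \<exists>x\<in>?J. y \<sqsubseteq>\<^bsub>L\<^esub> ?s \<squnion>\<^bsub>L\<^esub> x" using cofinal by blast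
  ultimately have "\<exists>I a s. lattice_ideal L I \<and> homogeneous L 5 a \<and> is_direct_sum L 4 a s \<and>
        (\<forall>x\<in>I.
           (\<exists>b. (\<forall>i<(5::nat) - 4. b i \<in> carrier L \<and> subperspective L (b i) (a 0)) \<and>
                x = \<Squnion>\<^bsub>L\<^esub> (b ` {..<(5::nat) - 4})) \<and>
           x \<sqinter>\<^bsub>L\<^esub> s = \<bottom>\<^bsub>L\<^esub>) \<and>
        (\<forall>y\<in>carrier L. \<exists>x\<in>I. y \<sqsubseteq>\<^bsub>L\<^esub> s \<squnion>\<^bsub>L\<^esub> x)"
    using ideal homogeneous_start s by (intro exI[of _ ?J] exI[of _ ?a] exI[of _ ?s] conjI) assumption+
  then show ?thesis
    unfolding entire_def using lat.modular_lattice_zero_axioms by simp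
qed

lemma not_coordinatizable: "\<not> coordinatizable L"
proof
  assume "coordinatizable L"
  then obtain R :: "('b + nat) ring" and f where R: "regular_ring R"
    and f: "bij_betw f (carrier L) (carrier (right_ideal_lattice R))" "order_emb L (right_ideal_lattice R) f"
    unfolding coordinatizable_def lattice_isomorphic_def by blast
  have im: "f ` g ` bounded_ideals = {x <#\<^bsub>R\<^esub> carrier R | x. x \<in> carrier R}"
    using f(1) by (simp add: bij_betw_def right_ideal_lattice_def)
  interpret R: regular_ring R by (rule R)
  interpret twisted_coordinatized S g R "\<lambda>A. f (g A)"
  proof
    show "\<exists>x\<in>carrier R. f (g A) = x <#\<^bsub>R\<^esub> carrier R" if "A \<in> bounded_ideals" for A
      using that im by blast
    show "\<exists>A\<in>bounded_ideals. f (g A) = x <#\<^bsub>R\<^esub> carrier R" if "x \<in> carrier R" for x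
    proof -
      have "x <#\<^bsub>R\<^esub> carrier R \<in> f ` g ` bounded_ideals" unfolding im using that by blast
      then show ?thesis by auto
    qed
    show "f (g A) \<subseteq> f (g B) \<longleftrightarrow> A \<subseteq> B" if "A \<in> bounded_ideals" "B \<in> bounded_ideals" for A B
      using f(2) that le_L[OF that] by (auto simp: order_emb_def right_ideal_lattice_def)
  qed
  show False by (rule no_coordinatization)
qed

text \<open>\<open>S\<close> itself coordinatizes the lattice; \<open>coordinatizableI\<close> moves
  to a ring on the type that the definition prescribes.\<close>

lemma coordinatizable_full: "coordinatizable (ord_of g rideals)"
proof (rule coordinatizableI[OF regular_ring_subring_record])
  interpret J: right_ideals S g rideals by (rule right_ideals_all)
  have "bij_betw (inv_into rideals g) (g ` rideals) rideals"
    using inj_g by (simp add: bij_betw_inv_into inj_on_imp_bij_betw)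
  moreover have "order_emb (ord_of g rideals) (right_ideal_lattice (subring_record S)) (inv_into rideals g)"
    unfolding order_emb_def
    using J.po.weak_partial_order_axioms weak_partial_order_right_ideal_lattice inj_g
    by (auto simp: right_ideal_lattice_def)
  ultimately show "lattice_isomorphic (ord_of g rideals) (right_ideal_lattice (subring_record S))"
    unfolding lattice_isomorphic_def using right_ideal_lattice_subring_record by auto
qed

lemma ideal_of_full:
  "lattice_ideal (ord_of g rideals) (g ` bounded_ideals) \<and> lattice_isomorphic L ((ord_of g rideals)\<lparr>carrier := g ` bounded_ideals\<rparr>)"
proof
  interpret J: right_ideals S g rideals by (rule right_ideals_all)
  show "lattice_ideal (ord_of g rideals) (g ` bounded_ideals)"
    unfolding lattice_ideal_def
  proof (intro conjI ballI impI)
    show "g ` bounded_ideals \<subseteq> carrier (ord_of g rideals)" using rideal_I by auto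
    show "g ` bounded_ideals \<noteq> {}" using I_zero by blast
    fix x assume "x \<in> g ` bounded_ideals"
    then obtain A where A: "A \<in> bounded_ideals" "x = g A" by blast
    show "y \<in> g ` bounded_ideals" if "y \<in> carrier (ord_of g rideals)" "y \<sqsubseteq>\<^bsub>ord_of g rideals\<^esub> x" for y
      using that A rideal_I[OF A(1)] I_down[OF A(1)] by auto
    show "x \<squnion>\<^bsub>ord_of g rideals\<^esub> y \<in> g ` bounded_ideals" if "y \<in> g ` bounded_ideals" for y
      using that A rideal_I I_psum by auto
  qed
  \<comment> \<open>The order of \<open>ord_of\<close> does not depend on the chosen ideal, so this
    is an equality and the isomorphism is the identity.\<close>
  have "(ord_of g rideals)\<lparr>carrier := g ` bounded_ideals\<rparr> = L" by (simp add: ord_of_def)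
  moreover have "lattice_isomorphic L L"
    unfolding lattice_isomorphic_def order_emb_def
    using po.weak_partial_order_axioms by (intro exI[of _ id]) auto
  ultimately show "lattice_isomorphic L ((ord_of g rideals)\<lparr>carrier := g ` bounded_ideals\<rparr>)" by simp
qed

text \<open>Each right ideal has a generator in \<open>S\<close>, which bounds the size from above;
  the ideals of the \<open>initial b\<close> are distinct and bound it from below.\<close>

lemma card_L:
  assumes "|S| \<le>o |UNIV :: w1 set|"
  shows "|carrier L| =o cardSuc natLeq"
proof -
  have "|g ` bounded_ideals| \<le>o |S|"
    using ordLeq_transitive[OF card_of_image[of g bounded_ideals] ordLeq_transitive[OF card_of_mono1[OF I_rideals]]]
      card_of_image[of rid S] by (simp add: rideals_def)
  then have 1: "|g ` bounded_ideals| \<le>o |UNIV :: w1 set|" using assms ordLeq_transitive by blast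
  have "b = c" if "rid (initial b) = rid (initial c)" for b c
  proof -
    have *: "c \<le> b" if "initial c \<in> rid (initial b)" for b c
    proof (rule ccontr)
      assume "\<not> c \<le> b"
      from that obtain r where "initial c = initial b * r" by (auto simp: rid_def)
      \<comment> \<open>If \<open>b < c\<close>, then at coordinate \<open>b\<close> the left side
        is 1, while \<open>initial b\<close> vanishes there.\<close>
      then have "initial c 0 b b = (initial b * r) 0 b b" by simp
      then show False using \<open>\<not> c \<le> b\<close> by (simp add: initial_def not_le split: if_splits)
    qed
    show ?thesis using *[of b c] *[of c b] that rid_self[of "initial b"] rid_self[of "initial c"] by auto
  qed
  then have "inj (\<lambda>b. g (rid (initial b)))" by (auto intro!: injI simp: g_eq_iff initial_bounded)
  moreover have "range (\<lambda>b. g (rid (initial b))) \<subseteq> g ` bounded_ideals" using initial_bounded by auto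
  ultimately have 2: "|UNIV :: w1 set| \<le>o |g ` bounded_ideals|" unfolding card_of_ordLeq[symmetric] by blast
  show ?thesis using 1 2 card_w1 ordIso_iff_ordLeq ordIso_transitive by (metis carrier_L)
qed

end

theorem theorem7p5:
  shows "\<exists>(L :: nat set gorder) (L' :: nat set gorder).
    sectionally_complemented_modular_lattice L \<and>
    entire 4 5 L \<and>
    \<not> coordinatizable L \<and>
    |carrier L| =o cardSuc natLeq \<and>
    complemented_modular_lattice L' \<and>
    (\<exists>a c. spanning_frame L' 5 a c) \<and>
    (\<exists>I. lattice_ideal L' I \<and> lattice_isomorphic L (L'\<lparr>carrier := I\<rparr>)) \<and>
    coordinatizable L'"
proof -
  obtain S where S: "regular_subring S" "generators \<subseteq> S" "S \<subseteq> almost_commuting" "|S| \<le>o |UNIV :: w1 set|"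
    using small_regular_subring[OF regular_almost_commuting generators_almost_commuting infinite_w1 card_generators] by metis
  interpret regular_subring S by fact
  have "|rideals| \<le>o |UNIV :: w1 set|"
    unfolding rideals_def using card_of_image S(4) ordLeq_transitive by blast
  moreover have "|UNIV :: w1 set| \<le>o |UNIV :: nat set set|"
    by (rule card_of_ordLeqI[of Rep_w1]) (auto simp: inj_def Rep_w1_inject)
  ultimately have "|rideals| \<le>o |UNIV :: nat set set|" using ordLeq_transitive by blast
  then obtain g :: "endo_family set \<Rightarrow> nat set" where g: "inj_on g rideals"
    unfolding card_of_ordLeq[symmetric] by blast
  interpret twisted S g by unfold_locales (use S g in auto)
  interpret J: right_ideals S g rideals by (rule right_ideals_all)
  show ?thesis
    using sectionally_complemented entire_4_5 not_coordinatizable card_L[OF S(4)] J.complemented(1) spanning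
      ideal_of_full coordinatizable_full
    by blast
qed

end
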